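(* Let $\mathbb{F}$ be an ordered field and let $\mathcal{A}_1=\{L^1_1,\ldots,L^1_n\}$, $\mathcal{A}_2=\{L^2_1,\ldots,L^2_n\}$ be two line arrangements in $\mathbb{F}^2$, each indexed in the order of increasing slopes $0\to\infty\to-\infty\to0$ (first non-negative slopes in increasing order, then the vertical line if present, then negative slopes in increasing order). Let $\phi:\mathcal{A}_1\to\mathcal{A}_2$ be the bijection $L^1_i\mapsto L^2_i$. Then $\phi$ is an isomorphism of line arrangements (there is a piecewise linear automorphism of $\mathbb{F}^2$ mapping $L^1_i$ onto $L^2_i$ for all $i$) if and only if for every four-element set of indices $\{i,j,k,l\}$, $\phi$ preserves nook points, i.e. the nook point of $\{L^1_i,L^1_j,L^1_k,L^1_l\}$ is $L^1_a\cap L^1_b$ exactly when the nook point of $\{L^2_i,L^2_j,L^2_k,L^2_l\}$ is $L^2_a\cap L^2_b$. Moreover, in this case there is a cyclic renumbering of the indices of one of the arrangements such that for every pair of corresponding four-element subsets the nook point intersections are identical (given by the same pair of indices).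
   Context: An ordered field is a totally ordered field with $x\le y\Rightarrow x+z\le y+z$ and $x,y\ge0\Rightarrow xy\ge0$. A line arrangement is a finite set of lines in $\mathbb{F}^2$, no two parallel and no three concurrent. A piecewise linear automorphism of $\mathbb{F}^2$ is a bijection affine on each piece of a finite decomposition of the plane into convex polygonal pieces. For a four-line arrangement, each line contains three of the six intersection points, ordered along the line; the nook point is the unique intersection point which is the middle of the three points on both of its lines. *)

theory Defs
  imports Main
begin

text \<open>
  The plane over an ordered field is the product type \<open>'a \<times> 'a\<close> with
  \<open>'a :: linordered_field\<close>.  The field carries no topology and the plane no
  \<open>real_vector\<close> structure, so the affine notions below are given in coordinates.
\<close>

type_synonym 'a plane_set = "('a \<times> 'a) set"

definition is_line :: "'a::linordered_field plane_set \<Rightarrow> bool" where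
  "is_line L \<longleftrightarrow> (\<exists>a b c. (a, b) \<noteq> (0, 0) \<and> L = {(x, y). a * x + b * y = c})"

definition parallel :: "'a::linordered_field plane_set \<Rightarrow> 'a plane_set \<Rightarrow> bool" where
  "parallel L K \<longleftrightarrow> L = K \<or> L \<inter> K = {}"

definition line_arrangement :: "'a::linordered_field plane_set set \<Rightarrow> bool" where
  "line_arrangement A \<longleftrightarrow>
     finite A \<and> (\<forall>L\<in>A. is_line L) \<and>
     (\<forall>L\<in>A. \<forall>K\<in>A. L \<noteq> K \<longrightarrow> \<not> parallel L K) \<and>
     (\<forall>L\<in>A. \<forall>K\<in>A. \<forall>M\<in>A. L \<noteq> K \<and> L \<noteq> M \<and> K \<noteq> M \<longrightarrow> L \<inter> K \<inter> M = {})"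


section \<open>The order of lines by slope\<close>

text \<open>The slope \<open>None\<close> is the infinite slope of a vertical line.\<close>

definition slope :: "'a::linordered_field plane_set \<Rightarrow> 'a option" where
  "slope L = (if \<exists>c. L = {(x, y). x = c} then None
              else Some (THE m. \<exists>c. L = {(x, y). y = m * x + c}))"

text \<open>The strict order \<open>0 \<rightarrow> \<infinity> \<rightarrow> -\<infinity> \<rightarrow> 0\<close> on slopes.\<close>

fun slope_less :: "'a::linordered_field option \<Rightarrow> 'a option \<Rightarrow> bool" where
  "slope_less (Some s) (Some t) \<longleftrightarrow>
     (0 \<le> s \<and> 0 \<le> t \<and> s < t) \<or> (0 \<le> s \<and> t < 0) \<or> (s < 0 \<and> t < 0 \<and> s < t)"
| "slope_less (Some s) None \<longleftrightarrow> 0 \<le> s"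
| "slope_less None (Some t) \<longleftrightarrow> t < 0"
| "slope_less None None \<longleftrightarrow> False"

text \<open>Only the values of \<open>L\<close> on \<open>{1..n}\<close> matter.\<close>

definition slope_indexed_arrangement :: "nat \<Rightarrow> (nat \<Rightarrow> 'a::linordered_field plane_set) \<Rightarrow> bool" where
  "slope_indexed_arrangement n L \<longleftrightarrow>
     line_arrangement (L ` {1..n}) \<and>
     (\<forall>i\<in>{1..n}. \<forall>j\<in>{1..n}. i < j \<longrightarrow> slope_less (slope (L i)) (slope (L j)))"


section \<open>Piecewise linear automorphisms\<close>

definition half_plane :: "'a::linordered_field plane_set \<Rightarrow> bool" where
  "half_plane H \<longleftrightarrow> (\<exists>a b c. (a, b) \<noteq> (0, 0) \<and> H = {(x, y). a * x + b * y \<le> c})"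

text \<open>Interior for the order topology of the plane: the points with an open square around them.\<close>

definition plane_interior :: "'a::linordered_field plane_set \<Rightarrow> 'a plane_set" where
  "plane_interior P =
     {p. \<exists>e>0. \<forall>q. \<bar>fst q - fst p\<bar> < e \<and> \<bar>snd q - snd p\<bar> < e \<longrightarrow> q \<in> P}"

text \<open>Pieces are closed and two-dimensional; they may be unbounded.\<close>

definition convex_polygonal_piece :: "'a::linordered_field plane_set \<Rightarrow> bool" where
  "convex_polygonal_piece P \<longleftrightarrow>
     (\<exists>\<H>. finite \<H> \<and> (\<forall>H\<in>\<H>. half_plane H) \<and> P = \<Inter>\<H>) \<and> plane_interior P \<noteq> {}"

definition polygonal_decomposition :: "'a::linordered_field plane_set set \<Rightarrow> bool" where
  "polygonal_decomposition D \<longleftrightarrow>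
     finite D \<and> (\<forall>P\<in>D. convex_polygonal_piece P) \<and> \<Union>D = UNIV \<and>
     (\<forall>P\<in>D. \<forall>Q\<in>D. P \<noteq> Q \<longrightarrow> plane_interior P \<inter> plane_interior Q = {})"

definition affine_map :: "('a::linordered_field \<times> 'a \<Rightarrow> 'a \<times> 'a) \<Rightarrow> bool" where
  "affine_map g \<longleftrightarrow>
     (\<exists>a b c d u v. \<forall>x y. g (x, y) = (a * x + b * y + u, c * x + d * y + v))"

text \<open>
  Since the pieces are closed and share their boundaries, the affine pieces of \<open>f\<close>
  agree on overlaps, so \<open>f\<close> is automatically continuous.
\<close>

definition pl_automorphism :: "('a::linordered_field \<times> 'a \<Rightarrow> 'a \<times> 'a) \<Rightarrow> bool" where
  "pl_automorphism f \<longleftrightarrow>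
     bij f \<and>
     (\<exists>D. polygonal_decomposition D \<and> (\<forall>P\<in>D. \<exists>g. affine_map g \<and> (\<forall>p\<in>P. f p = g p)))"

definition arrangement_isomorphism ::
  "'a::linordered_field plane_set set \<Rightarrow> 'a plane_set set \<Rightarrow> ('a plane_set \<Rightarrow> 'a plane_set) \<Rightarrow> bool" where
  "arrangement_isomorphism A B \<phi> \<longleftrightarrow>
     bij_betw \<phi> A B \<and> (\<exists>f. pl_automorphism f \<and> (\<forall>L\<in>A. f ` L = \<phi> L))"


section \<open>Nook points\<close>

definition intersection_points :: "'a::linordered_field plane_set set \<Rightarrow> 'a plane_set" where
  "intersection_points A = {p. \<exists>L\<in>A. \<exists>K\<in>A. L \<noteq> K \<and> p \<in> L \<inter> K}"

definition strictly_between ::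
  "'a::linordered_field \<times> 'a \<Rightarrow> 'a \<times> 'a \<Rightarrow> 'a \<times> 'a \<Rightarrow> bool" where
  "strictly_between q p r \<longleftrightarrow>
     q \<noteq> r \<and>
     (\<exists>t. 0 < t \<and> t < 1 \<and>
          p = ((1 - t) * fst q + t * fst r, (1 - t) * snd q + t * snd r))"

definition middle_point_on ::
  "'a::linordered_field plane_set set \<Rightarrow> 'a plane_set \<Rightarrow> 'a \<times> 'a \<Rightarrow> bool" where
  "middle_point_on A L p \<longleftrightarrow>
     (\<exists>q r. intersection_points A \<inter> L = {q, p, r} \<and> strictly_between q p r)"

text \<open>Meaningful only when \<open>A\<close> is an arrangement of four lines.\<close>

definition nook_point :: "'a::linordered_field plane_set set \<Rightarrow> 'a \<times> 'a" where
  "nook_point A =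
     (THE p. \<exists>L\<in>A. \<exists>K\<in>A. L \<noteq> K \<and> p \<in> L \<inter> K \<and> middle_point_on A L p \<and> middle_point_on A K p)"


section \<open>Cyclic renumbering\<close>

text \<open>The shift of the index set \<open>{1..n}\<close> by \<open>c\<close> places; \<open>c = 0\<close> is the trivial renumbering.\<close>

definition cyclic_shift :: "nat \<Rightarrow> nat \<Rightarrow> nat \<Rightarrow> nat" where
  "cyclic_shift n c i = (i - 1 + c) mod n + 1"

end

theory Submission
  imports Defs
begin

text \<open>
  Homogenise: a line becomes a linear form on three-space, the line at infinity the form \<open>z\<close>, and
  the slope order fixes the forms up to a common sign. On four lines with increasing slopes the
  orientations of the four triples change sign at most once (Grassmann--Pluecker), and the nook point
  records where. So preserving nook points means that all triples keep their orientation or all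
  reverse it; the latter is undone by negating the forms of one arrangement.

  Equal orientations give the same sign vectors of points. Choose a representative for every sign
  vector, normalised to the same value of \<open>z\<close> in both arrangements. Every point is a unique positive
  combination of the representatives of a chain of faces, and replacing representatives by those of
  the other arrangement is a bijection that preserves sign vectors and is linear on the cone of each
  maximal chain. In the plane \<open>z = 1\<close> it is the piecewise linear automorphism.

  Conversely, a piecewise linear automorphism carrying lines to lines is an injective piecewise
  affine function of one variable on each line; such a function has the intermediate value property
  and hence preserves betweenness, so it carries nook points to nook points. In particular the
  trivial renumbering serves in the second claim.
\<close>

section \<open>Linear forms and sign vectors\<close>

text \<open>The line at infinity is one more index of the configuration, so vertices at infinity and
  unbounded edges and cells are treated like all others. An arbitrary ordered field offers neither
  limits nor compactness, so existence arguments have to be finite: a point moves along a line until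
  the first of finitely many forms vanishes, and inductions run over the number of forms that do not
  vanish. Orientations of triples determine the sign vectors because every nonzero vector is a sum,
  without cancellation of signs, of vectors lying on two of the planes; the signs of such a vector
  are, up to a common factor, orientations of triples. The chains of faces give a subdivision of
  barycentric type; it refers to sign vectors alone and hence exists on both sides with the same
  combinatorics. Negating the line forms but not \<open>z\<close> keeps the orientation of triples
  that contain \<open>z\<close> and reverses all others, which is why a global reversal is harmless.
  Three independent forms are required to separate points, so arrangements of fewer than two lines
  are handled apart.\<close>

datatype 'a vec3 = Vec3 (xcoord: 'a) (ycoord: 'a) (zcoord: 'a)

instantiation vec3 :: (ab_group_add) ab_group_add
begin

definition zero_vec3 :: "'a vec3" where
  "zero_vec3 = Vec3 0 0 0"

fun plus_vec3 :: "'a vec3 \<Rightarrow> 'a vec3 \<Rightarrow> 'a vec3" where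
  "plus_vec3 (Vec3 a b c) (Vec3 x y z) = Vec3 (a + x) (b + y) (c + z)"

fun minus_vec3 :: "'a vec3 \<Rightarrow> 'a vec3 \<Rightarrow> 'a vec3" where
  "minus_vec3 (Vec3 a b c) (Vec3 x y z) = Vec3 (a - x) (b - y) (c - z)"

fun uminus_vec3 :: "'a vec3 \<Rightarrow> 'a vec3" where
  "uminus_vec3 (Vec3 a b c) = Vec3 (- a) (- b) (- c)"

instance
proof
  fix u v w :: "'a vec3"
  show "u + v + w = u + (v + w)" by (cases u; cases v; cases w) (simp add: add.assoc)
  show "u + v = v + u" by (cases u; cases v) (simp add: add.commute)
  show "0 + u = u" by (cases u) (simp add: zero_vec3_def)
  show "- u + u = 0" by (cases u) (simp add: zero_vec3_def)
  show "u - v = u + - v" by (cases u; cases v) simp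
qed

end

fun dot :: "'a::linordered_field vec3 \<Rightarrow> 'a vec3 \<Rightarrow> 'a" (infixl "\<bullet>" 70) where
  "Vec3 a b c \<bullet> Vec3 x y z = a * x + b * y + c * z"

fun scale :: "'a::linordered_field \<Rightarrow> 'a vec3 \<Rightarrow> 'a vec3" (infixr "\<odot>" 75) where
  "t \<odot> Vec3 x y z = Vec3 (t * x) (t * y) (t * z)"

fun cross :: "'a::linordered_field vec3 \<Rightarrow> 'a vec3 \<Rightarrow> 'a vec3" where
  "cross (Vec3 a b c) (Vec3 d e f) = Vec3 (b * f - c * e) (c * d - a * f) (a * e - b * d)"

definition det3 :: "'a::linordered_field vec3 \<Rightarrow> 'a vec3 \<Rightarrow> 'a vec3 \<Rightarrow> 'a" where
  "det3 u v w = cross u v \<bullet> w"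

section \<open>Algebra of forms and determinants\<close>

lemma dot_add [simp]: "l \<bullet> (p + q) = l \<bullet> p + l \<bullet> q"
  by (cases l; cases p; cases q) (simp add: algebra_simps)

lemma dot_diff [simp]: "l \<bullet> (p - q) = l \<bullet> p - l \<bullet> q"
  by (cases l; cases p; cases q) (simp add: algebra_simps)

lemma dot_minus [simp]: "l \<bullet> (- p) = - (l \<bullet> p)"
  by (cases l; cases p) (simp add: algebra_simps)

lemma dot_zero [simp]: "l \<bullet> 0 = 0"
  by (cases l) (simp add: zero_vec3_def)

lemma dot_scale [simp]: "l \<bullet> (t \<odot> p) = t * (l \<bullet> p)"
  by (cases l; cases p) (simp add: algebra_simps)

lemma add_dot [simp]: "(p + q) \<bullet> l = p \<bullet> l + q \<bullet> l"
  by (cases l; cases p; cases q) (simp add: algebra_simps)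

lemma diff_dot [simp]: "(p - q) \<bullet> l = p \<bullet> l - q \<bullet> l"
  by (cases l; cases p; cases q) (simp add: algebra_simps)

lemma scale_dot [simp]: "(t \<odot> p) \<bullet> l = t * (p \<bullet> l)"
  by (cases l; cases p) (simp add: algebra_simps)

lemma scale_simps [simp]: "0 \<odot> p = 0" "1 \<odot> p = p" "t \<odot> 0 = 0" "t \<odot> (s \<odot> p) = (t * s) \<odot> p"
  by (cases p; simp add: zero_vec3_def algebra_simps)+

lemma scale_eq_0_iff [simp]: "t \<odot> p = 0 \<longleftrightarrow> t = 0 \<or> p = 0"
  by (cases p) (auto simp: zero_vec3_def)

lemma scale_left_distrib: "(s + t) \<odot> p = s \<odot> p + t \<odot> p"
  by (cases p) (simp add: algebra_simps)

lemma scale_right_distrib: "t \<odot> (p + q) = t \<odot> p + t \<odot> q"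
  by (cases p; cases q) (simp add: algebra_simps)

lemma scale_minus [simp]: "(- s) \<odot> p = - (s \<odot> p)" "s \<odot> (- p) = - (s \<odot> p)"
  by (cases p; simp add: algebra_simps)+

lemma zcoord_scale [simp]: "zcoord (t \<odot> p) = t * zcoord p"
  by (cases p) simp

lemma cross_dot [simp]: "u \<bullet> cross u v = 0" "v \<bullet> cross u v = 0"
  by (cases u; cases v; simp add: algebra_simps)+

lemma dot_cross: "w \<bullet> cross u v = det3 u v w"
  unfolding det3_def by (cases u; cases v; cases w) (simp add: algebra_simps)

lemma det3_rotate: "det3 v w u = det3 u v w"
  unfolding det3_def by (cases u; cases v; cases w) (simp add: algebra_simps)

lemma det3_swap: "det3 v u w = - det3 u v w"
  unfolding det3_def by (cases u; cases v; cases w) (simp add: algebra_simps)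

text \<open>Cramer's rule: the three cross products, divided by the determinant, are the basis dual
  to \<open>u\<close>, \<open>v\<close>, \<open>w\<close>.\<close>

lemma det3_expand: "det3 u v w \<odot> p = (u \<bullet> p) \<odot> cross v w + (v \<bullet> p) \<odot> cross w u + (w \<bullet> p) \<odot> cross u v"
  unfolding det3_def by (cases u; cases v; cases w; cases p) (simp add: algebra_simps)

lemma det3_eqI:
  assumes "det3 u v w \<noteq> 0" "u \<bullet> p = u \<bullet> q" "v \<bullet> p = v \<bullet> q" "w \<bullet> p = w \<bullet> q"
  shows "p = q"
proof -
  have "det3 u v w \<odot> p = det3 u v w \<odot> q"
    using assms(2-4) by (simp add: det3_expand)
  then have "(1 / det3 u v w) \<odot> (det3 u v w \<odot> p) = (1 / det3 u v w) \<odot> (det3 u v w \<odot> q)"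
    by simp
  then show ?thesis using assms(1) by simp
qed

section \<open>Sign vectors and their change along a line\<close>

definition signs :: "'i set \<Rightarrow> ('i \<Rightarrow> 'a::linordered_field vec3) \<Rightarrow> 'a vec3 \<Rightarrow> 'i \<Rightarrow> 'a" where
  "signs I l p = (\<lambda>i. if i \<in> I then sgn (l i \<bullet> p) else 0)"

text \<open>The face relation of an oriented matroid: the face with sign vector \<open>X\<close>
  lies in the closure of the face with sign vector \<open>Y\<close>.\<close>

definition conforms :: "('i \<Rightarrow> 'a::zero) \<Rightarrow> ('i \<Rightarrow> 'a) \<Rightarrow> bool" where
  "conforms X Y \<longleftrightarrow> (\<forall>i. X i \<noteq> 0 \<longrightarrow> X i = Y i)"

lemma conforms_refl [simp]: "conforms X X"
  by (simp add: conforms_def)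

lemma conforms_trans: "conforms X Y \<Longrightarrow> conforms Y Z \<Longrightarrow> conforms X Z"
  by (auto simp: conforms_def)

text \<open>Two vectors in the closure of one face never have opposite signs, so nothing cancels.
  The right-hand side is the composition of covectors.\<close>

lemma signs_add:
  assumes "conforms (signs I l p) X" "conforms (signs I l q) X"
  shows "signs I l (p + q) = (\<lambda>i. if signs I l p i \<noteq> 0 then signs I l p i else signs I l q i)"
proof
  fix i
  show "signs I l (p + q) i = (if signs I l p i \<noteq> 0 then signs I l p i else signs I l q i)"
    using assms[unfolded conforms_def, rule_format, of i]
    by (auto simp: signs_def sgn_if split: if_splits)
qed

lemma conforms_signs_add:
  assumes "conforms (signs I l p) X" "conforms (signs I l q) X"
  shows "conforms (signs I l (p + q)) X"
  using assms unfolding signs_add[OF assms] by (auto simp: conforms_def)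

lemma signs_scale:
  assumes "0 < t" shows "signs I l (t \<odot> p) = signs I l p"
  using assms by (auto simp: signs_def sgn_mult)

lemma signs_zero [simp]: "signs I l 0 = (\<lambda>i. 0)"
  by (auto simp: signs_def)

lemma conforms_signs_scale:
  assumes "0 \<le> t" "conforms (signs I l p) X"
  shows "conforms (signs I l (t \<odot> p)) X"
  using assms by (cases "t = 0") (auto simp: signs_scale conforms_def)

lemma signs_add_scale:
  assumes "conforms (signs I l q) X" "signs I l p = X" "0 < t"
  shows "signs I l (q + t \<odot> p) = X"
  using signs_add[OF assms(1), of "t \<odot> p"] signs_scale[OF assms(3), of I l p] assms
  by (auto simp: conforms_def)

text \<open>Here \<open>a\<close> is the value of a form at the start and \<open>b\<close> its rate
  of change; if the form moves towards zero, it gets there at time \<open>- a / b\<close>, and up to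
  that time the sign can only be lost, not reversed.\<close>

lemma sgn_before_hit:
  fixes a b r :: "'a::linordered_field"
  assumes "a + r * b \<noteq> 0" "0 < r" "a = 0 \<Longrightarrow> b = 0" "a * b < 0 \<Longrightarrow> r \<le> - a / b"
  shows "sgn (a + r * b) = sgn a"
proof (cases "a * b < 0")
  case True
  then have "r \<le> - a / b" by (rule assms)
  with True have "a > 0 \<and> 0 \<le> a + r * b \<or> a < 0 \<and> a + r * b \<le> 0"
    by (auto simp: mult_less_0_iff field_simps)
  then show ?thesis using assms(1) by (auto simp: sgn_if)
next
  case False
  then have "a = 0 \<and> b = 0 \<or> 0 < a \<and> 0 \<le> r * b \<or> a < 0 \<and> r * b \<le> 0"
    using assms(2,3) by (cases rule: linorder_cases[of a 0]) (auto simp: mult_less_0_iff not_less mult_le_0_iff)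
  then show ?thesis using assms(1) by (auto simp: sgn_if)
qed

text \<open>A step short enough for all of the finitely many forms keeps every nonzero sign and
  fills the zeros with the signs of the direction \<open>d\<close>.\<close>

lemma signs_perturb:
  assumes "finite I"
  obtains e where "0 < e" "signs I l (p + e \<odot> d) = (\<lambda>i. if signs I l p i \<noteq> 0 then signs I l p i else signs I l d i)"
proof -
  have "\<exists>e>0. \<forall>i\<in>I. \<forall>t. 0 < t \<and> t \<le> e \<longrightarrow> sgn (l i \<bullet> (p + t \<odot> d)) = (if l i \<bullet> p \<noteq> 0 then sgn (l i \<bullet> p) else sgn (l i \<bullet> d))"
    using assms
  proof (induction I)
    case empty
    show ?case by (auto intro: exI[of _ 1])
  next
    case (insert i I)
    then obtain e where e: "e > 0" "\<forall>i\<in>I. \<forall>t. 0 < t \<and> t \<le> e \<longrightarrow> sgn (l i \<bullet> (p + t \<odot> d)) = (if l i \<bullet> p \<noteq> 0 then sgn (l i \<bullet> p) else sgn (l i \<bullet> d))"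
      by blast
    have "\<exists>e>0. \<forall>t. 0 < t \<and> t \<le> e \<longrightarrow> sgn (l i \<bullet> (p + t \<odot> d)) = (if l i \<bullet> p \<noteq> 0 then sgn (l i \<bullet> p) else sgn (l i \<bullet> d))"
    proof (cases "l i \<bullet> p = 0")
      case True
      then show ?thesis by (auto intro!: exI[of _ 1] simp: sgn_mult)
    next
      case False
      define a b where "a = l i \<bullet> p" and "b = l i \<bullet> d"
      \<comment> \<open>Up to this distance the change \<open>t * b\<close> stays below
        \<open>\<bar>a\<bar>\<close> in absolute value; the summand 1 keeps the denominator positive
        when \<open>b = 0\<close>.\<close>
      define e where "e = \<bar>a\<bar> / (2 * (\<bar>b\<bar> + 1))"
      have "0 < e" using False by (simp add: e_def a_def)
      moreover have "sgn (a + t * b) = sgn a" if "0 < t" "t \<le> e" for t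
      proof -
        have "\<bar>t * b\<bar> = t * \<bar>b\<bar>" using that by (simp add: abs_mult)
        also have "\<dots> \<le> e * \<bar>b\<bar>" using that by (simp add: mult_right_mono)
        also have "\<dots> < e * (2 * (\<bar>b\<bar> + 1))" using \<open>0 < e\<close> by (intro mult_strict_left_mono) auto
        also have "\<dots> = \<bar>a\<bar>" unfolding e_def by (simp add: add_nonneg_eq_0_iff)
        finally show ?thesis by (auto simp: sgn_if abs_if split: if_splits)
      qed
      ultimately show ?thesis using False by (auto intro!: exI[of _ e] simp: a_def b_def)
    qed
    then obtain e' where "e' > 0" "\<forall>t. 0 < t \<and> t \<le> e' \<longrightarrow> sgn (l i \<bullet> (p + t \<odot> d)) = (if l i \<bullet> p \<noteq> 0 then sgn (l i \<bullet> p) else sgn (l i \<bullet> d))" by blast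
    with e show ?case by (intro exI[of _ "min e e'"]) auto
  qed
  then obtain e where "e > 0" "\<forall>i\<in>I. sgn (l i \<bullet> (p + e \<odot> d)) = (if l i \<bullet> p \<noteq> 0 then sgn (l i \<bullet> p) else sgn (l i \<bullet> d))"
    by blast
  then show ?thesis by (intro that[of e]) (auto simp: signs_def fun_eq_iff sgn_eq_0_iff)
qed

text \<open>Walk from \<open>p\<close> in direction \<open>d\<close> and stop when the first form
  vanishes: the face is not left, but its boundary is reached. The last hypothesis keeps the walk
  inside all planes through \<open>p\<close>, so no new sign appears.\<close>

lemma signs_hit:
  assumes "finite I" "k \<in> I" "(l k \<bullet> p) * (l k \<bullet> d) < 0"
    and zeros: "\<And>i. i \<in> I \<Longrightarrow> l i \<bullet> p = 0 \<Longrightarrow> l i \<bullet> d = 0"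
  obtains s i where "0 < s" "conforms (signs I l (p + s \<odot> d)) (signs I l p)"
    "i \<in> I" "l i \<bullet> p \<noteq> 0" "l i \<bullet> (p + s \<odot> d) = 0"
proof -
  define K where "K = {i\<in>I. (l i \<bullet> p) * (l i \<bullet> d) < 0}"
  \<comment> \<open>The time at which form \<open>i\<close> vanishes; it is positive exactly for the
    indices in \<open>K\<close>.\<close>
  define r where "r i = - (l i \<bullet> p) / (l i \<bullet> d)" for i
  have K: "finite K" "K \<noteq> {}" using assms by (auto simp: K_def)
  then obtain i where i: "i \<in> K" "\<And>j. j \<in> K \<Longrightarrow> r i \<le> r j"
    using ex_min_if_finite[of "r ` K"] by (metis (no_types, lifting) arg_min_if_finite(1) arg_min_least)
  have rpos: "0 < r j" if "j \<in> K" for j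
    using that by (auto simp: K_def r_def mult_less_0_iff field_simps zero_less_divide_iff divide_less_0_iff)
  have "conforms (signs I l (p + r i \<odot> d)) (signs I l p)"
    unfolding conforms_def
  proof (intro allI impI)
    fix j assume nz: "signs I l (p + r i \<odot> d) j \<noteq> 0"
    then have j: "j \<in> I" by (auto simp: signs_def split: if_splits)
    define a b where "a = l j \<bullet> p" and "b = l j \<bullet> d"
    have "a + r i * b \<noteq> 0" using nz j by (auto simp: signs_def a_def b_def split: if_splits)
    moreover have "r i > 0" using rpos i by blast
    moreover have "a = 0 \<Longrightarrow> b = 0" using zeros[OF j] by (simp add: a_def b_def)
    moreover have "a * b < 0 \<Longrightarrow> r i \<le> - a / b" using i(2)[of j] j by (simp add: K_def r_def a_def b_def)
    ultimately have "sgn (a + r i * b) = sgn a" by (rule sgn_before_hit)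
    then show "signs I l (p + r i \<odot> d) j = signs I l p j" by (simp add: signs_def a_def b_def)
  qed
  moreover have "l i \<bullet> (p + r i \<odot> d) = 0" "l i \<bullet> p \<noteq> 0" "i \<in> I" using i(1) by (auto simp: K_def r_def)
  ultimately show ?thesis using that rpos i by blast
qed


section \<open>Configurations in general position and conformal decomposition\<close>

definition is_vertex :: "'i set \<Rightarrow> ('i \<Rightarrow> 'a::linordered_field vec3) \<Rightarrow> 'a vec3 \<Rightarrow> bool" where
  "is_vertex I l p \<longleftrightarrow> p \<noteq> 0 \<and> (\<exists>i\<in>I. \<exists>j\<in>I. i \<noteq> j \<and> l i \<bullet> p = 0 \<and> l j \<bullet> p = 0)"

locale vector_configuration =
  fixes I :: "'i set" and l :: "'i \<Rightarrow> 'a::linordered_field vec3"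
  assumes finite_I: "finite I"
    and card_I: "3 \<le> card I"
    and generic: "\<lbrakk>i \<in> I; j \<in> I; k \<in> I; i \<noteq> j; i \<noteq> k; j \<noteq> k\<rbrakk> \<Longrightarrow> det3 (l i) (l j) (l k) \<noteq> 0"
begin

lemma obtain_other:
  obtains k where "k \<in> I" "k \<noteq> i" "k \<noteq> j"
proof -
  have "card {i, j} < card I" using card_I by (simp add: card_insert_if)
  then have "\<not> I \<subseteq> {i, j}" by (meson card_mono finite.emptyI finite.insertI not_less)
  then show ?thesis using that by blast
qed

lemma eqI:
  assumes "i \<in> I" "j \<in> I" "k \<in> I" "i \<noteq> j" "i \<noteq> k" "j \<noteq> k"
    and "l i \<bullet> p = l i \<bullet> q" "l j \<bullet> p = l j \<bullet> q" "l k \<bullet> p = l k \<bullet> q"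
  shows "p = q"
  using det3_eqI[OF generic] assms by blast

lemma signs_eq_zero_iff: "signs I l p = (\<lambda>i. 0) \<longleftrightarrow> p = 0"
proof
  assume *: "signs I l p = (\<lambda>i. 0)"
  have zero: "l i \<bullet> p = 0" if "i \<in> I" for i
    using fun_cong[OF *, of i] that by (simp add: signs_def sgn_eq_0_iff)
  obtain i where "i \<in> I" using obtain_other[of undefined undefined] by blast
  moreover obtain j where "j \<in> I" "j \<noteq> i" using obtain_other[of i i] by blast
  moreover obtain k where "k \<in> I" "k \<noteq> i" "k \<noteq> j" using obtain_other[of i j] by blast
  ultimately show "p = 0" using eqI[of i j k p 0] zero by auto
qed simp

lemma finite_supp: "finite {i. signs I l p i \<noteq> 0}"
  by (rule finite_subset[OF _ finite_I]) (auto simp: signs_def)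

lemma card_supp_less:
  assumes "conforms (signs I l q) (signs I l p)" "i \<in> I" "l i \<bullet> p \<noteq> 0" "l i \<bullet> q = 0"
  shows "card {i. signs I l q i \<noteq> 0} < card {i. signs I l p i \<noteq> 0}"
proof (rule psubset_card_mono[OF finite_supp])
  have "i \<in> {i. signs I l p i \<noteq> 0}" "i \<notin> {i. signs I l q i \<noteq> 0}"
    using assms by (auto simp: signs_def sgn_eq_0_iff)
  moreover have "{i. signs I l q i \<noteq> 0} \<subseteq> {i. signs I l p i \<noteq> 0}"
    using assms(1) by (auto simp: conforms_def)
  ultimately show "{i. signs I l q i \<noteq> 0} \<subset> {i. signs I l p i \<noteq> 0}" by blast
qed

text \<open>A vector that is no vertex lies on at most one plane, so a line through it stays in that
  plane. If the line leaves the face on both sides, \<open>p\<close> is a convex combination of the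
  two exit points, which have smaller support. If it leaves on one side only, \<open>p\<close> is
  the exit point plus a multiple of the direction, and the direction, chosen on two planes, is a
  vertex.\<close>

lemma conformal_split:
  assumes "p \<noteq> 0" "\<not> is_vertex I l p"
  obtains q r where "p = q + r" "q \<noteq> 0" "r \<noteq> 0"
    "conforms (signs I l q) (signs I l p)" "conforms (signs I l r) (signs I l p)"
    "is_vertex I l q \<or> card {i. signs I l q i \<noteq> 0} < card {i. signs I l p i \<noteq> 0}"
    "is_vertex I l r \<or> card {i. signs I l r i \<noteq> 0} < card {i. signs I l p i \<noteq> 0}"
proof -
  \<comment> \<open>The index \<open>i\<close> is the form vanishing at \<open>p\<close> if there is
    one, and arbitrary otherwise.\<close>
  obtain i where i: "i \<in> I" "\<And>j. j \<in> I \<Longrightarrow> l j \<bullet> p = 0 \<Longrightarrow> j = i"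
    using assms obtain_other[of undefined undefined] unfolding is_vertex_def by metis
  obtain j where j: "j \<in> I" "j \<noteq> i" using obtain_other[of i i] by blast
  obtain k where k: "k \<in> I" "k \<noteq> i" "k \<noteq> j" using obtain_other[of i j] by blast
  define c where "c = cross (l i) (l j)"
  have kc: "l k \<bullet> c \<noteq> 0" using generic[of i j k] i j k by (simp add: c_def dot_cross)
  have kp: "l k \<bullet> p \<noteq> 0" using i k by blast
  \<comment> \<open>The sign is chosen so that form \<open>k\<close> decreases in absolute value
    along \<open>d\<close>; hence at least this direction leaves the face.\<close>
  define d where "d = (if (l k \<bullet> p) * (l k \<bullet> c) < 0 then c else - c)"
  have kd: "(l k \<bullet> p) * (l k \<bullet> d) < 0"
    using kc kp by (auto simp: d_def not_less mult_le_0_iff mult_less_0_iff zero_le_mult_iff)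
  have d0: "l i \<bullet> d = 0" "l j \<bullet> d = 0" by (auto simp: d_def c_def)
  have dnz: "d \<noteq> 0" using kc by (auto simp: d_def)
  have zeros: "l h \<bullet> d = 0" "l h \<bullet> (- d) = 0" if "h \<in> I" "l h \<bullet> p = 0" for h
    using i(2)[OF that] d0 by auto
  obtain s h where s: "0 < s" "conforms (signs I l (p + s \<odot> d)) (signs I l p)"
      "h \<in> I" "l h \<bullet> p \<noteq> 0" "l h \<bullet> (p + s \<odot> d) = 0"
    using signs_hit[of I k l p d] finite_I k(1) kd zeros by metis
  have vd: "is_vertex I l (t \<odot> d)" if "t \<noteq> 0" for t
  proof -
    have "t \<odot> d \<noteq> 0" using kd that by (metis dot_scale dot_zero mult_eq_0_iff mult_zero_right order_less_irrefl)
    then show ?thesis using d0 i j by (auto simp: is_vertex_def)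
  qed
  \<comment> \<open>If the line through \<open>p\<close> met the origin, \<open>p\<close> would be a
    multiple of \<open>d\<close> and hence a vertex.\<close>
  have nz: "p + t \<odot> d \<noteq> 0" if "t \<noteq> 0" for t
  proof
    assume "p + t \<odot> d = 0"
    then have "p = (- t) \<odot> d" by (simp add: eq_neg_iff_add_eq_0)
    then show False using assms(2) vd[of "- t"] that by simp
  qed
  show ?thesis
  proof (cases "\<exists>k\<in>I. (l k \<bullet> p) * (l k \<bullet> (- d)) < 0")
    case True
    then obtain s' h' where s': "0 < s'" "conforms (signs I l (p + s' \<odot> (- d))) (signs I l p)"
        "h' \<in> I" "l h' \<bullet> p \<noteq> 0" "l h' \<bullet> (p + s' \<odot> (- d)) = 0"
      using signs_hit[of I _ l p "- d"] finite_I zeros(2) by metis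
    \<comment> \<open>The weights with which \<open>p\<close> divides the segment between the two
      exit points, at distances \<open>s\<close> and \<open>s'\<close>.\<close>
    define a b where "a = s' / (s + s')" and "b = s / (s + s')"
    have ab: "0 < a" "0 < b" using s(1) s'(1) by (auto simp: a_def b_def)
    have "a + b = 1" "a * s = b * s'"
      using s(1) s'(1) by (auto simp: a_def b_def mult.commute simp flip: add_divide_distrib)
    moreover have "a \<odot> (p + s \<odot> d) + b \<odot> (p + s' \<odot> (- d)) = (a + b) \<odot> p + (a * s - b * s') \<odot> d"
      by (cases p; cases d) (simp add: algebra_simps)
    ultimately have "p = a \<odot> (p + s \<odot> d) + b \<odot> (p + s' \<odot> (- d))"
      by simp
    moreover have "a \<odot> (p + s \<odot> d) \<noteq> 0" "b \<odot> (p + s' \<odot> (- d)) \<noteq> 0"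
      using ab nz[of s] nz[of "- s'"] s(1) s'(1) by auto
    moreover have "signs I l (a \<odot> (p + s \<odot> d)) = signs I l (p + s \<odot> d)"
      "signs I l (b \<odot> (p + s' \<odot> (- d))) = signs I l (p + s' \<odot> (- d))"
      using ab signs_scale by blast+
    ultimately show ?thesis
      using that[of "a \<odot> (p + s \<odot> d)" "b \<odot> (p + s' \<odot> (- d))"] s(2) s'(2)
        card_supp_less[OF s(2-5)] card_supp_less[OF s'(2-5)] by metis
  next
    case False
    have "conforms (signs I l (- d)) (signs I l p)"
      unfolding conforms_def
    proof (intro allI impI)
      fix m assume "signs I l (- d) m \<noteq> 0"
      then have m: "m \<in> I" "l m \<bullet> d \<noteq> 0" by (auto simp: signs_def split: if_splits)
      then have "l m \<bullet> p \<noteq> 0" using zeros by blast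
      moreover have "\<not> 0 < (l m \<bullet> p) * (l m \<bullet> d)" using False m(1) by simp
      ultimately show "signs I l (- d) m = signs I l p m"
        using m by (auto simp: signs_def sgn_if zero_less_mult_iff)
    qed
    then show ?thesis
      using that[of "p + s \<odot> d" "s \<odot> (- d)"] s nz[of s] vd[of "- s"] card_supp_less[OF s(2-5)]
      by (auto simp: signs_scale[of s I l "- d", simplified] is_vertex_def)
  qed
qed

text \<open>Splitting lowers the number of nonzero signs unless it produces a vertex, so it ends.
  This is the counterpart of the fact that every covector is a composition of cocircuits.\<close>

lemma conformal_induct [consumes 1, case_names vertex add]:
  assumes "p \<noteq> 0"
    and vertex: "\<And>p. is_vertex I l p \<Longrightarrow> P p"
    and add: "\<And>p q r. \<lbrakk>p = q + r; q \<noteq> 0; r \<noteq> 0; conforms (signs I l q) (signs I l p);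
                conforms (signs I l r) (signs I l p); P q; P r\<rbrakk> \<Longrightarrow> P p"
  shows "P p"
  using assms(1)
proof (induction "card {i. signs I l p i \<noteq> 0}" arbitrary: p rule: less_induct)
  case less
  show ?case
  proof (cases "is_vertex I l p")
    case False
    from conformal_split[OF less.prems this] show ?thesis
      using add vertex less.hyps by metis
  qed (rule vertex)
qed

lemma vertex_below:
  assumes "p \<noteq> 0"
  obtains v where "is_vertex I l v" "conforms (signs I l v) (signs I l p)"
proof -
  from assms have "\<exists>v. is_vertex I l v \<and> conforms (signs I l v) (signs I l p)"
  proof (induction p rule: conformal_induct)
    case (add p q r)
    then show ?case using conforms_trans by blast
  next
    case (vertex p)
    then show ?case using conforms_refl by blast
  qed
  then show ?thesis using that by blast
qed


end

section \<open>Flags of faces\<close>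

text \<open>Since \<open>signs\<close> is 0 off \<open>I\<close>, configurations on the same index
  set can be compared by equality of these sets.\<close>

definition covectors :: "'i set \<Rightarrow> ('i \<Rightarrow> 'a::linordered_field vec3) \<Rightarrow> ('i \<Rightarrow> 'a) set" where
  "covectors I l = range (signs I l)"

text \<open>The normalisation makes the image of a representative under a transfer between two
  configurations keep the value of the form \<open>h\<close>.\<close>

definition rep :: "'i set \<Rightarrow> ('i \<Rightarrow> 'a::linordered_field vec3) \<Rightarrow> 'i \<Rightarrow> ('i \<Rightarrow> 'a) \<Rightarrow> 'a vec3" where
  "rep I l h X = (SOME p. signs I l p = X \<and> l h \<bullet> p = X h)"

lemma rep:
  assumes "X \<in> covectors I l" "h \<in> I"
  shows signs_rep: "signs I l (rep I l h X) = X"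
    and dot_rep: "l h \<bullet> rep I l h X = X h"
proof -
  obtain p where p: "X = signs I l p" using assms by (auto simp: covectors_def)
  define t where "t = (if l h \<bullet> p = 0 then 1 else 1 / \<bar>l h \<bullet> p\<bar>)"
  have "signs I l (t \<odot> p) = X" by (simp add: p t_def signs_scale)
  moreover have "l h \<bullet> (t \<odot> p) = X h" using assms(2) by (auto simp: p t_def signs_def sgn_if)
  ultimately have "\<exists>p. signs I l p = X \<and> l h \<bullet> p = X h" by blast
  then have "signs I l (rep I l h X) = X \<and> l h \<bullet> rep I l h X = X h"
    unfolding rep_def by (rule someI_ex)
  then show "signs I l (rep I l h X) = X" "l h \<bullet> rep I l h X = X h" by auto
qed

text \<open>A complete chain vertex, edge, cell. The indices \<open>i\<close> and \<open>j\<close>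
  witness that both steps of the chain are proper, and they give the three representatives a
  triangular shape. The condition \<open>Z h = 1\<close> selects the cells on the positive side of
  \<open>h\<close>, which is the side of the plane \<open>z = 1\<close> when \<open>h\<close> is the
  line at infinity.\<close>

definition is_flag :: "'i set \<Rightarrow> ('i \<Rightarrow> 'a::linordered_field vec3) \<Rightarrow> 'i \<Rightarrow> ('i \<Rightarrow> 'a) \<Rightarrow> ('i \<Rightarrow> 'a) \<Rightarrow> ('i \<Rightarrow> 'a) \<Rightarrow> bool" where
  "is_flag I l h X Y Z \<longleftrightarrow>
     X \<in> covectors I l \<and> Y \<in> covectors I l \<and> Z \<in> covectors I l \<and> conforms X Y \<and> conforms Y Z \<and> Z h = 1 \<and>
     X \<noteq> (\<lambda>i. 0) \<and> (\<exists>i\<in>I. \<exists>j\<in>I. i \<noteq> j \<and> X i = 0 \<and> X j = 0 \<and> Y i = 0 \<and> Y j \<noteq> 0 \<and> Z i \<noteq> 0)"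

context vector_configuration
begin

text \<open>Subtract the largest multiple of the representative that keeps the vector in the closure
  of the face; the remainder then lies on a proper face. If \<open>p\<close> already lies on a
  proper face, the multiple is 0.\<close>

lemma peel:
  assumes "h \<in> I" "X \<in> covectors I l" "X \<noteq> (\<lambda>i. 0)" "conforms (signs I l p) X"
  obtains t q i where "0 \<le> t" "signs I l p = X \<Longrightarrow> 0 < t" "p = q + t \<odot> rep I l h X"
    "conforms (signs I l q) X" "i \<in> I" "X i \<noteq> 0" "l i \<bullet> q = 0"
proof (cases "signs I l p = X")
  case True
  have r: "signs I l (rep I l h X) = X" by (rule signs_rep[OF assms(2,1)])
  obtain k where k: "X k \<noteq> 0" using assms(3) by auto
  then have kI: "k \<in> I" using True by (auto simp: signs_def split: if_splits)
  have sgn_eq: "sgn (l i \<bullet> p) = sgn (l i \<bullet> rep I l h X)" if "i \<in> I" for i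
    using fun_cong[OF True, of i] fun_cong[OF r, of i] that by (simp add: signs_def)
  have "l k \<bullet> p * (l k \<bullet> (- rep I l h X)) < 0"
    using sgn_eq[OF kI] k True kI
    by (auto simp: signs_def sgn_if mult_less_0_iff zero_less_mult_iff split: if_splits)
  moreover have "l i \<bullet> (- rep I l h X) = 0" if "i \<in> I" "l i \<bullet> p = 0" for i
    using sgn_eq[OF that(1)] that(2) by (simp add: sgn_eq_0_iff eq_commute[of 0])
  ultimately obtain s i where "0 < s" "conforms (signs I l (p + s \<odot> (- rep I l h X))) (signs I l p)"
      "i \<in> I" "l i \<bullet> p \<noteq> 0" "l i \<bullet> (p + s \<odot> (- rep I l h X)) = 0"
    using signs_hit[of I k l p "- rep I l h X"] finite_I kI by metis
  then show ?thesis using that[of s "p - s \<odot> rep I l h X" i] True by (auto simp: signs_def sgn_eq_0_iff)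
next
  case False
  then obtain i where i: "signs I l p i \<noteq> X i" by blast
  then have "signs I l p i = 0" "X i \<noteq> 0" using assms(4) by (auto simp: conforms_def)
  moreover from this have "i \<in> I" using assms(2) by (auto simp: covectors_def signs_def split: if_splits)
  ultimately show ?thesis using that[of 0 p i] assms(4) False by (auto simp: signs_def sgn_eq_0_iff)
qed

section \<open>Cells and edges above a vector, and the covering by cones of flags\<close>

lemma signs_zero_iff: "i \<in> I \<Longrightarrow> signs I l p i = 0 \<longleftrightarrow> l i \<bullet> p = 0"
  by (simp add: signs_def sgn_eq_0_iff)

lemma three_zeros:
  assumes "i \<in> I" "j \<in> I" "k \<in> I" "i \<noteq> j" "i \<noteq> k" "j \<noteq> k" "l i \<bullet> p = 0" "l j \<bullet> p = 0" "l k \<bullet> p = 0"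
  shows "p = 0"
  using eqI[of i j k p 0] assms by simp

lemma obtain_values:
  assumes "i \<in> I" "j \<in> I" "i \<noteq> j"
  obtains d where "l i \<bullet> d = a" "l j \<bullet> d = b"
proof -
  obtain k where k: "k \<in> I" "k \<noteq> i" "k \<noteq> j" using obtain_other[of i j] by blast
  define D where "D = det3 (l i) (l j) (l k)"
  have D: "D \<noteq> 0" using generic[of i j k] assms k by (simp add: D_def)
  have "det3 (l j) (l k) (l i) = D" "det3 (l k) (l i) (l j) = D"
    unfolding D_def by (metis det3_rotate)+
  then show ?thesis
    using that[of "(a / D) \<odot> cross (l j) (l k) + (b / D) \<odot> cross (l k) (l i)"] D
    by (simp add: dot_cross)
qed

text \<open>At most two forms vanish at a nonzero vector; a small step in a direction where both are
  positive makes every form nonzero.\<close>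

lemma cell_above:
  assumes "p \<noteq> 0"
  obtains Z where "Z \<in> covectors I l" "conforms (signs I l p) Z" "\<And>i. i \<in> I \<Longrightarrow> Z i \<noteq> 0"
proof -
  have "\<exists>i j. i \<in> I \<and> j \<in> I \<and> i \<noteq> j \<and> (\<forall>k\<in>I. l k \<bullet> p = 0 \<longrightarrow> k = i \<or> k = j)"
  proof (rule ccontr)
    assume *: "\<not> ?thesis"
    obtain a where a: "a \<in> I" using obtain_other[of undefined undefined] by blast
    obtain b where b: "b \<in> I" "b \<noteq> a" using obtain_other[of a a] by blast
    obtain i where i: "i \<in> I" "l i \<bullet> p = 0" using * a b by metis
    obtain b' where b': "b' \<in> I" "b' \<noteq> i" using obtain_other[of i i] by blast
    obtain j where j: "j \<in> I" "l j \<bullet> p = 0" "j \<noteq> i" using * i b' by metis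
    obtain k where "k \<in> I" "l k \<bullet> p = 0" "k \<noteq> i" "k \<noteq> j" using * i j by metis
    then show False using three_zeros[of i j k p] i j assms by auto
  qed
  then obtain i j where ij: "i \<in> I" "j \<in> I" "i \<noteq> j" "\<And>k. k \<in> I \<Longrightarrow> l k \<bullet> p = 0 \<Longrightarrow> k = i \<or> k = j"
    by blast
  obtain d where d: "l i \<bullet> d = 1" "l j \<bullet> d = 1" using obtain_values[OF ij(1-3)] by blast
  obtain e where "0 < e" and e: "signs I l (p + e \<odot> d) = (\<lambda>i. if signs I l p i \<noteq> 0 then signs I l p i else signs I l d i)"
    using signs_perturb[OF finite_I] by blast
  show ?thesis
  proof (rule that[of "signs I l (p + e \<odot> d)"])
    show "signs I l (p + e \<odot> d) k \<noteq> 0" if "k \<in> I" for k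
      unfolding e using ij(4)[OF that] d that by (auto simp: signs_zero_iff)
    show "conforms (signs I l p) (signs I l (p + e \<odot> d))" by (simp add: e conforms_def)
  qed (simp add: covectors_def)
qed

text \<open>If a second form \<open>j\<close> vanishes at \<open>q\<close>, a small step inside the
  plane of \<open>i\<close>, towards the side of \<open>j\<close> on which \<open>Z\<close> lies,
  leads from the vertex into an edge of the cell.\<close>

lemma edge_above:
  assumes q: "q \<noteq> 0" "i \<in> I" "l i \<bullet> q = 0" "conforms (signs I l q) Z" and Z: "Z \<in> covectors I l" "\<And>i. i \<in> I \<Longrightarrow> Z i \<noteq> 0"
  obtains Y where "Y \<in> covectors I l" "conforms (signs I l q) Y" "conforms Y Z" "Y i = 0"
    "\<And>j. j \<in> I \<Longrightarrow> j \<noteq> i \<Longrightarrow> Y j \<noteq> 0"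
proof (cases "\<exists>j\<in>I. j \<noteq> i \<and> l j \<bullet> q = 0")
  case False
  then show ?thesis using that[of "signs I l q"] q by (auto simp: covectors_def signs_zero_iff)
next
  case True
  then obtain j where j: "j \<in> I" "j \<noteq> i" "l j \<bullet> q = 0" by blast
  have only: "k = i \<or> k = j" if "k \<in> I" "l k \<bullet> q = 0" for k
    using three_zeros[of i j k q] q j that by auto
  obtain d where d: "l i \<bullet> d = 0" "l j \<bullet> d = Z j" using obtain_values[of i j 0 "Z j"] q j by metis
  obtain e where "0 < e" and e: "signs I l (q + e \<odot> d) = (\<lambda>i. if signs I l q i \<noteq> 0 then signs I l q i else signs I l d i)"
    using signs_perturb[OF finite_I] by blast
  obtain z where "Z = signs I l z" using Z by (auto simp: covectors_def)
  \<comment> \<open>A covector has values in -1, 0, 1 only, so \<open>Z j\<close> serves both as a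
    prescribed value of a form and as its sign.\<close>
  then have "sgn (Z j) = Z j" by (auto simp: signs_def)
  then have dj: "signs I l d j = Z j" using d j by (simp add: signs_def)
  show ?thesis
  proof (rule that[of "signs I l (q + e \<odot> d)"])
    show "conforms (signs I l (q + e \<odot> d)) Z"
      unfolding conforms_def
    proof (intro allI impI)
      fix k assume k: "signs I l (q + e \<odot> d) k \<noteq> 0"
      then have "k \<in> I" by (auto simp: signs_def split: if_splits)
      show "signs I l (q + e \<odot> d) k = Z k"
      proof (cases "signs I l q k = 0")
        case True
        then have "k = i \<or> k = j" using only \<open>k \<in> I\<close> by (simp add: signs_zero_iff)
        moreover have "signs I l d i = 0" using d q by (simp add: signs_zero_iff)
        ultimately show ?thesis using k True dj by (auto simp: e)
      next
        case False
        then show ?thesis using q(4) by (simp add: e conforms_def)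
      qed
    qed
    show "signs I l (q + e \<odot> d) i = 0" using q d by (simp add: signs_zero_iff)
    show "signs I l (q + e \<odot> d) k \<noteq> 0" if "k \<in> I" "k \<noteq> i" for k
    proof (cases "k = j")
      case True
      then show ?thesis using signs_zero_iff[OF j(1), of q] j(3) dj Z(2)[OF j(1)] by (simp add: e)
    next
      case False
      then have "signs I l q k \<noteq> 0" using only[OF that(1)] that by (auto simp: signs_zero_iff)
      then show ?thesis by (simp add: e)
    qed
    show "conforms (signs I l q) (signs I l (q + e \<odot> d))" by (simp add: e conforms_def)
  qed (simp add: covectors_def)
qed

text \<open>Peeling the edge and then the vertex leaves a remainder on the three planes
  \<open>i\<close>, \<open>j\<close>, \<open>k\<close>, which is 0 by general position.\<close>

lemma flag_edge:
  assumes h: "h \<in> I" and q: "q \<noteq> 0" "i \<in> I" "l i \<bullet> q = 0" "conforms (signs I l q) Z"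
    and Z: "Z \<in> covectors I l" "\<And>i. i \<in> I \<Longrightarrow> Z i \<noteq> 0"
  obtains X Y j a b where "X \<in> covectors I l" "Y \<in> covectors I l" "conforms X Y" "conforms Y Z"
    "X \<noteq> (\<lambda>i. 0)" "j \<in> I" "i \<noteq> j" "X i = 0" "X j = 0" "Y i = 0" "Y j \<noteq> 0"
    "0 \<le> a" "0 \<le> b" "q = a \<odot> rep I l h X + b \<odot> rep I l h Y"
proof -
  obtain Y where Y: "Y \<in> covectors I l" "conforms (signs I l q) Y" "conforms Y Z" "Y i = 0"
    "\<And>j. j \<in> I \<Longrightarrow> j \<noteq> i \<Longrightarrow> Y j \<noteq> 0"
    using edge_above[OF q Z] by blast
  have "Y \<noteq> (\<lambda>i. 0)" using Y(5) obtain_other[of i i] by metis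
  then obtain b r j where r: "0 \<le> b" "q = r + b \<odot> rep I l h Y" "conforms (signs I l r) Y"
      "j \<in> I" "Y j \<noteq> 0" "l j \<bullet> r = 0"
    using peel[OF h Y(1) _ Y(2)] by metis
  have ri: "l i \<bullet> r = 0"
    using r(3) Y(4) q(2) unfolding conforms_def by (metis signs_zero_iff)
  have ij: "i \<noteq> j" using r Y by auto
  show ?thesis
  proof (cases "r = 0")
    case False
    define X where "X = signs I l r"
    have X: "X \<in> covectors I l" "X \<noteq> (\<lambda>i. 0)" using False by (auto simp: X_def covectors_def signs_eq_zero_iff)
    obtain a s k where s: "0 \<le> a" "r = s + a \<odot> rep I l h X" "conforms (signs I l s) X" "k \<in> I" "X k \<noteq> 0" "l k \<bullet> s = 0"
      using peel[OF h X] conforms_refl[of X] X_def by metis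
    have X0: "X i = 0" "X j = 0" using ri r q by (auto simp: X_def signs_zero_iff)
    have "signs I l s i = 0" "signs I l s j = 0"
      using s(3) X0 unfolding conforms_def by metis+
    then have "l i \<bullet> s = 0" "l j \<bullet> s = 0" using q(2) r(4) by (simp_all add: signs_zero_iff)
    moreover have "k \<noteq> i" "k \<noteq> j" using X0 s(5) by auto
    ultimately have "s = 0" using three_zeros[of i j k s] q r s ij by auto
    then have "q = a \<odot> rep I l h X + b \<odot> rep I l h Y" using r(2) s(2) by simp
    moreover have "conforms X Y" using r(3) X_def by simp
    ultimately show ?thesis
      using that[of X Y j a b, OF X(1) Y(1) _ Y(3) X(2) r(4) ij X0 Y(4) r(5) s(1) r(1)] by blast
  next
    \<comment> \<open>Here \<open>q\<close> is a multiple of the edge representative; any vertex of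
      the edge completes the chain, with coefficient 0.\<close>
    case True
    obtain y where y: "Y = signs I l y" using Y by (auto simp: covectors_def)
    then have "y \<noteq> 0" using \<open>Y \<noteq> (\<lambda>i. 0)\<close> by auto
    then obtain v where v: "is_vertex I l v" "conforms (signs I l v) Y" using vertex_below y by metis
    have vi: "signs I l v i = 0" using v(2) Y(4) unfolding conforms_def by metis
    obtain m where m: "m \<in> I" "m \<noteq> i" "l m \<bullet> v = 0" using v(1) unfolding is_vertex_def by metis
    then show ?thesis
      using that[of "signs I l v" Y m 0 b] v vi Y r True
      by (auto simp: covectors_def signs_eq_zero_iff is_vertex_def signs_zero_iff)
  qed
qed

text \<open>Choose a cell having \<open>p\<close> in its closure and peel its representative; the
  remainder lies on a plane of the configuration and is split along an edge and a vertex.\<close>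

lemma flag_cover:
  assumes h: "h \<in> I" and p: "0 < l h \<bullet> p"
  obtains X Y Z a b c where "is_flag I l h X Y Z" "0 \<le> a" "0 \<le> b" "0 \<le> c"
    "p = a \<odot> rep I l h X + b \<odot> rep I l h Y + c \<odot> rep I l h Z"
proof -
  have "p \<noteq> 0" using p by auto
  then obtain Z where Z: "Z \<in> covectors I l" "conforms (signs I l p) Z" "\<And>i. i \<in> I \<Longrightarrow> Z i \<noteq> 0"
    using cell_above by blast
  then have "Z \<noteq> (\<lambda>i. 0)" using h by auto
  have Zh: "Z h = 1" using Z(2) h p by (auto simp: conforms_def signs_def dest!: spec[of _ h])
  obtain c q i where c: "0 \<le> c" "p = q + c \<odot> rep I l h Z" "conforms (signs I l q) Z" "i \<in> I" "Z i \<noteq> 0" "l i \<bullet> q = 0"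
    using peel[OF h Z(1) \<open>Z \<noteq> _\<close> Z(2)] by metis
  show ?thesis
  proof (cases "q = 0")
    case False
    show ?thesis
      using flag_edge[OF h False c(4,6,3) Z(1,3)] that[where Z = Z and c = c] c Z Zh
      unfolding is_flag_def by (smt (verit))
  next
    \<comment> \<open>Now \<open>p\<close> is a multiple of the cell representative. An arbitrary
      vertex of the cell supplies a flag, and its two lower coefficients are 0.\<close>
    case True
    obtain z where z: "Z = signs I l z" using Z by (auto simp: covectors_def)
    then have "z \<noteq> 0" using \<open>Z \<noteq> (\<lambda>i. 0)\<close> by auto
    then obtain v where v: "is_vertex I l v" "conforms (signs I l v) Z" using vertex_below z by metis
    then obtain m where m: "m \<in> I" "l m \<bullet> v = 0" unfolding is_vertex_def by metis
    have "v \<noteq> 0" using v(1) by (simp add: is_vertex_def)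
    obtain X Y j where "X \<in> covectors I l" "Y \<in> covectors I l" "conforms X Y" "conforms Y Z"
      "X \<noteq> (\<lambda>i. 0)" "j \<in> I" "m \<noteq> j" "X m = 0" "X j = 0" "Y m = 0" "Y j \<noteq> 0"
      using flag_edge[OF h \<open>v \<noteq> 0\<close> m v(2) Z(1,3)] by metis
    then have "is_flag I l h X Y Z" using Z(1,3) Zh m unfolding is_flag_def by metis
    then show ?thesis using that[of X Y Z 0 0 c] c True by simp
  qed
qed

text \<open>The representatives of a flag are a basis: \<open>l i\<close> is nonzero only on the
  cell representative among them, \<open>l j\<close> vanishes on the vertex but not on the edge, and
  a third form is nonzero on the vertex. The coordinate forms come from this triangular system by
  back substitution.\<close>

lemma flag_dual:
  assumes h: "h \<in> I" and "is_flag I l h X Y Z"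
  obtains \<alpha> \<beta> \<gamma> where
    "\<And>p. p = (\<alpha> \<bullet> p) \<odot> rep I l h X + (\<beta> \<bullet> p) \<odot> rep I l h Y + (\<gamma> \<bullet> p) \<odot> rep I l h Z"
    "\<And>a b c. \<alpha> \<bullet> (a \<odot> rep I l h X + b \<odot> rep I l h Y + c \<odot> rep I l h Z) = a"
    "\<And>a b c. \<beta> \<bullet> (a \<odot> rep I l h X + b \<odot> rep I l h Y + c \<odot> rep I l h Z) = b"
    "\<And>a b c. \<gamma> \<bullet> (a \<odot> rep I l h X + b \<odot> rep I l h Y + c \<odot> rep I l h Z) = c"
proof -
  define u v w where "u = rep I l h X" and "v = rep I l h Y" and "w = rep I l h Z"
  obtain i j where *: "X \<in> covectors I l" "Y \<in> covectors I l" "Z \<in> covectors I l"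
    "X \<noteq> (\<lambda>i. 0)" "i\<in>I" "j\<in>I" "i \<noteq> j" "X i = 0" "X j = 0" "Y i = 0" "Y j \<noteq> 0" "Z i \<noteq> 0"
    using assms(2) unfolding is_flag_def by blast
  have s: "signs I l u = X" "signs I l v = Y" "signs I l w = Z"
    unfolding u_def v_def w_def using *(1-3) by (simp_all add: signs_rep[OF _ h])
  have z: "l i \<bullet> u = 0" "l j \<bullet> u = 0" "l i \<bullet> v = 0" "l j \<bullet> v \<noteq> 0" "l i \<bullet> w \<noteq> 0"
    using * s signs_zero_iff by metis+
  obtain k where k: "k \<in> I" "k \<noteq> i" "k \<noteq> j" using obtain_other[of i j] by blast
  have "l k \<bullet> u \<noteq> 0" using three_zeros[of i j k u] * k z s by auto
  define \<gamma> where "\<gamma> = (1 / (l i \<bullet> w)) \<odot> l i"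
  define \<beta> where "\<beta> = (1 / (l j \<bullet> v)) \<odot> (l j - (l j \<bullet> w) \<odot> \<gamma>)"
  define \<alpha> where "\<alpha> = (1 / (l k \<bullet> u)) \<odot> (l k - (l k \<bullet> v) \<odot> \<beta> - (l k \<bullet> w) \<odot> \<gamma>)"
  have g: "\<gamma> \<bullet> u = 0" "\<gamma> \<bullet> v = 0" "\<gamma> \<bullet> w = 1" using z by (auto simp: \<gamma>_def)
  have b: "\<beta> \<bullet> u = 0" "\<beta> \<bullet> v = 1" "\<beta> \<bullet> w = 0" using z g by (auto simp: \<beta>_def)
  have a: "\<alpha> \<bullet> u = 1" "\<alpha> \<bullet> v = 0" "\<alpha> \<bullet> w = 0" using \<open>l k \<bullet> u \<noteq> 0\<close> g b by (auto simp: \<alpha>_def)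
  have "p = (\<alpha> \<bullet> p) \<odot> u + (\<beta> \<bullet> p) \<odot> v + (\<gamma> \<bullet> p) \<odot> w" for p
  proof (rule eqI[of i j k])
    show "l i \<bullet> p = l i \<bullet> ((\<alpha> \<bullet> p) \<odot> u + (\<beta> \<bullet> p) \<odot> v + (\<gamma> \<bullet> p) \<odot> w)" using z by (simp add: \<gamma>_def)
    show "l j \<bullet> p = l j \<bullet> ((\<alpha> \<bullet> p) \<odot> u + (\<beta> \<bullet> p) \<odot> v + (\<gamma> \<bullet> p) \<odot> w)" using z by (simp add: \<beta>_def field_simps)
    show "l k \<bullet> p = l k \<bullet> ((\<alpha> \<bullet> p) \<odot> u + (\<beta> \<bullet> p) \<odot> v + (\<gamma> \<bullet> p) \<odot> w)"
      using \<open>l k \<bullet> u \<noteq> 0\<close> by (simp add: \<alpha>_def field_simps)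
  qed (use * k in auto)
  then show ?thesis using that[of \<alpha> \<beta> \<gamma>] a b g unfolding u_def v_def w_def by simp
qed

end

section \<open>Transfer between configurations with the same sign vectors\<close>

lemma det3_repeat [simp]: "det3 u v u = 0" "det3 u v v = 0"
  unfolding det3_def by (cases u; cases v; simp add: algebra_simps)+

text \<open>A vertex is a multiple of a cross product, on which form \<open>m\<close> takes that
  multiple of an orientation; so its signs can be copied to the other configuration. Conformal sums
  carry this to all vectors.\<close>

lemma covectors_subset:
  assumes "vector_configuration I l" "vector_configuration I l'"
    and same: "\<And>i j k. \<lbrakk>i \<in> I; j \<in> I; k \<in> I; i \<noteq> j; i \<noteq> k; j \<noteq> k\<rbrakk> \<Longrightarrow>
      sgn (det3 (l i) (l j) (l k)) = sgn (det3 (l' i) (l' j) (l' k))"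
  shows "covectors I l \<subseteq> covectors I l'"
proof -
  interpret A: vector_configuration I l by fact
  interpret B: vector_configuration I l' by fact
  have "\<exists>p'. signs I l' p' = signs I l p" if "p \<noteq> 0" for p
    using that
  proof (induction p rule: A.conformal_induct)
    case (vertex v)
    then obtain i j where ij: "i \<in> I" "j \<in> I" "i \<noteq> j" "l i \<bullet> v = 0" "l j \<bullet> v = 0"
      unfolding is_vertex_def by blast
    obtain k where k: "k \<in> I" "k \<noteq> i" "k \<noteq> j" using A.obtain_other[of i j] by blast
    \<comment> \<open>The same factor \<open>t\<close> is used with the cross product of the other
      configuration; only its sign matters there.\<close>
    define t where "t = (l k \<bullet> v) / det3 (l i) (l j) (l k)"
    have "v = t \<odot> cross (l i) (l j)"
      by (rule A.eqI[of i j k]) (use ij k A.generic[of i j k] in \<open>simp_all add: t_def dot_cross\<close>)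
    moreover have "signs I l' (t \<odot> cross (l' i) (l' j)) = signs I l (t \<odot> cross (l i) (l j))"
    proof
      fix m
      show "signs I l' (t \<odot> cross (l' i) (l' j)) m = signs I l (t \<odot> cross (l i) (l j)) m"
        using same[of i j m] ij by (cases "m = i \<or> m = j") (auto simp: signs_def sgn_mult dot_cross)
    qed
    ultimately show ?case by metis
  next
    case (add p q r)
    then obtain q' r' where qr: "signs I l' q' = signs I l q" "signs I l' r' = signs I l r" by blast
    have "signs I l' (q' + r') = signs I l (q + r)"
      unfolding signs_add[OF add(4,5)]
      by (subst signs_add[where X = "signs I l p"]) (simp_all only: qr add(4,5))
    then show ?case using add(1) by metis
  qed
  moreover have "signs I l' 0 = signs I l 0" by simp
  ultimately show ?thesis unfolding covectors_def by (metis image_subsetI rangeI)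
qed

text \<open>Both vectors are built along one chain of faces with the same coefficients. Requiring
  each partial sum to lie in a proper face of the next \<open>X\<close>, and \<open>t\<close> to be
  positive, makes the chain strictly increasing and the expansion unique; this is what turns the
  relation into the graph of a bijection.\<close>

inductive link for I :: "'i set" and h :: 'i and l l' :: "'i \<Rightarrow> 'a::linordered_field vec3" where
  zero: "link I h l l' 0 0"
| step: "\<lbrakk>link I h l l' q q'; X \<in> covectors I l; conforms (signs I l q) X; signs I l q \<noteq> X; 0 < t\<rbrakk> \<Longrightarrow>
    link I h l l' (q + t \<odot> rep I l h X) (q' + t \<odot> rep I l' h X)"

locale configuration_pair = A: vector_configuration I l + B: vector_configuration I l'
  for I :: "'i set" and l l' :: "'i \<Rightarrow> 'a::linordered_field vec3" +
  fixes h
  assumes h_in: "h \<in> I"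
    and same_covectors: "covectors I l = covectors I l'"
begin

lemma swap: "configuration_pair I l' l h"
  by unfold_locales (simp_all add: h_in same_covectors)

text \<open>The sign vector of a partial sum is its last face, on both sides; the value of
  \<open>h\<close> agrees because both representatives take the value \<open>X h\<close>.\<close>

lemma link_signs: "link I h l l' p p' \<Longrightarrow> signs I l' p' = signs I l p \<and> l' h \<bullet> p' = l h \<bullet> p"
proof (induction rule: link.induct)
  case (step q q' X t)
  have "signs I l (q + t \<odot> rep I l h X) = X"
    using step signs_rep[OF _ h_in] by (intro signs_add_scale) auto
  moreover have "signs I l' (q' + t \<odot> rep I l' h X) = X"
    using step signs_rep[OF _ h_in, of X l'] same_covectors by (intro signs_add_scale) auto
  ultimately show ?case
    using step dot_rep[OF _ h_in, of X l] dot_rep[OF _ h_in, of X l'] same_covectors by simp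
qed simp

lemma link_swap: "link I h l l' p p' \<Longrightarrow> link I h l' l p' p"
proof (induction rule: link.induct)
  case (step q q' X t)
  then show ?case
    using link_signs[OF step(1)] same_covectors by (intro link.step) auto
qed (rule link.zero)

text \<open>Peeling the face of \<open>p\<close> itself leaves a remainder with smaller
  support.\<close>

lemma link_total: "\<exists>p'. link I h l l' p p'"
proof (induction "card {i. signs I l p i \<noteq> 0}" arbitrary: p rule: less_induct)
  case less
  show ?case
  proof (cases "p = 0")
    case False
    define X where "X = signs I l p"
    have X: "X \<in> covectors I l" "X \<noteq> (\<lambda>i. 0)" "conforms (signs I l p) X"
      using False by (auto simp: X_def covectors_def A.signs_eq_zero_iff)
    obtain t q i where q: "signs I l p = X \<Longrightarrow> 0 < t" "p = q + t \<odot> rep I l h X" "conforms (signs I l q) X"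
        "i \<in> I" "X i \<noteq> 0" "l i \<bullet> q = 0"
      using A.peel[OF h_in X] by metis
    have "l i \<bullet> p \<noteq> 0" using q(4,5) A.signs_zero_iff by (simp add: X_def)
    then obtain q' where "link I h l l' q q'"
      using less(1)[of q] A.card_supp_less[of q p i] q(3,4,6) by (auto simp: X_def)
    moreover have "signs I l q \<noteq> X" using q A.signs_zero_iff by metis
    ultimately have "link I h l l' (q + t \<odot> rep I l h X) (q' + t \<odot> rep I l' h X)"
      using link.step[OF _ X(1) q(3) _ q(1)[OF X_def[symmetric]]] by blast
    then show ?thesis using q(2) by metis
  qed (metis link.zero)
qed

text \<open>The face is the sign vector of the sum. If the coefficients differed, the remainder
  belonging to the smaller one would contain a positive multiple of the representative and so lie in
  the face itself, not on its boundary.\<close>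

lemma decomposition_unique:
  assumes "q + t \<odot> rep I l h X = r + s \<odot> rep I l h Y" "X \<in> covectors I l" "Y \<in> covectors I l"
    "conforms (signs I l q) X" "conforms (signs I l r) Y" "signs I l q \<noteq> X" "signs I l r \<noteq> Y" "0 < t" "0 < s"
  shows "X = Y \<and> q = r \<and> t = s"
proof -
  have "signs I l (q + t \<odot> rep I l h X) = X" "signs I l (r + s \<odot> rep I l h Y) = Y"
    using assms signs_rep[OF _ h_in, of X l] signs_rep[OF _ h_in, of Y l] by (blast intro: signs_add_scale)+
  then have XY: "X = Y" using assms(1) by simp
  have rX: "signs I l (rep I l h X) = X" by (rule signs_rep[OF assms(2) h_in])
  have le: "\<not> a < b" if "u + a \<odot> rep I l h X = w + b \<odot> rep I l h X" "conforms (signs I l w) X" "signs I l u \<noteq> X" for a b u w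
  proof
    assume "a < b"
    have "u = w + b \<odot> rep I l h X - a \<odot> rep I l h X" using that(1) by (simp add: eq_diff_eq)
    also have "\<dots> = w + (b - a) \<odot> rep I l h X"
      using scale_left_distrib[of "b - a" a "rep I l h X"] by simp
    finally have "signs I l u = X" using signs_add_scale[OF that(2) rX, of "b - a"] \<open>a < b\<close> by simp
    then show False using that by blast
  qed
  have "t = s" using le[of q t r s] le[of r s q t] assms XY by (metis linorder_neqE)
  then show ?thesis using assms(1) XY by simp
qed

lemma link_unique: "link I h l l' p p' \<Longrightarrow> link I h l l' p p'' \<Longrightarrow> p' = p''"
proof (induction arbitrary: p'' rule: link.induct)
  case zero
  then show ?case
  proof (cases rule: link.cases)
    case (step q q' X t)
    then have "signs I l (q + t \<odot> rep I l h X) = X"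
      using signs_rep[OF _ h_in] by (intro signs_add_scale) auto
    then have "X = (\<lambda>i. 0)" using step(1) by (metis signs_zero)
    then have "signs I l q = X" using step(5) by (auto simp: conforms_def)
    then show ?thesis using step by blast
  qed simp
next
  case (step q q' X t)
  from step.prems show ?case
  proof (cases rule: link.cases)
    case zero
    have "signs I l (q + t \<odot> rep I l h X) = X"
      using step signs_rep[OF _ h_in] by (intro signs_add_scale) auto
    then have "X = (\<lambda>i. 0)" using zero(1) by (metis signs_zero)
    then have "signs I l q = X" using step.hyps by (auto simp: conforms_def)
    then show ?thesis using step by blast
  next
    case step': (step r r' Y s)
    have "X = Y \<and> q = r \<and> t = s"
      using step step' by (intro decomposition_unique) auto
    then show ?thesis using step.IH step' by metis
  qed
qed

definition transfer :: "'a vec3 \<Rightarrow> 'a vec3" where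
  "transfer p = (THE p'. link I h l l' p p')"

lemma transfer_eqI: "link I h l l' p p' \<Longrightarrow> transfer p = p'"
  unfolding transfer_def using link_unique by blast

lemma link_transfer: "link I h l l' p (transfer p)"
  using link_total transfer_eqI by metis

lemma transfer_signs:
  "signs I l' (transfer p) = signs I l p" "l' h \<bullet> transfer p = l h \<bullet> p"
  using link_signs[OF link_transfer] by auto

lemma transfer_swap: "configuration_pair.transfer I l' l h (transfer p) = p"
  using configuration_pair.transfer_eqI[OF swap link_swap[OF link_transfer]] .

text \<open>A zero coefficient means that the face is skipped; this covers the boundaries of the
  cones.\<close>

lemma link_step_ge:
  assumes "link I h l l' q q'" "X \<in> covectors I l" "conforms (signs I l q) X" "signs I l q \<noteq> X" "0 \<le> t"
  shows "link I h l l' (q + t \<odot> rep I l h X) (q' + t \<odot> rep I l' h X)"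
  using assms link.step[OF assms(1-4), of t] by (cases "t = 0") auto

lemma flag_below:
  assumes "is_flag I l h X Y Z" "0 \<le> a" "0 \<le> b"
  defines "u \<equiv> a \<odot> rep I l h X" and "v \<equiv> a \<odot> rep I l h X + b \<odot> rep I l h Y"
  shows "conforms (signs I l 0) X" "signs I l 0 \<noteq> X" "conforms (signs I l u) Y" "signs I l u \<noteq> Y"
    "conforms (signs I l v) Z" "signs I l v \<noteq> Z"
proof -
  obtain i j where *: "X \<in> covectors I l" "Y \<in> covectors I l" "Z \<in> covectors I l" "conforms X Y" "conforms Y Z"
    "X \<noteq> (\<lambda>i. 0)" "i\<in>I" "j\<in>I" "i \<noteq> j" "X i = 0" "X j = 0" "Y i = 0" "Y j \<noteq> 0" "Z i \<noteq> 0"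
    using assms(1) unfolding is_flag_def by blast
  have s: "signs I l (rep I l h X) = X" "signs I l (rep I l h Y) = Y" "signs I l (rep I l h Z) = Z"
    using *(1-3) by (simp_all add: signs_rep[OF _ h_in])
  have uX: "conforms (signs I l u) X"
    unfolding u_def using s(1) by (intro conforms_signs_scale assms(2)) simp
  have "conforms (signs I l (b \<odot> rep I l h Y)) Y"
    using s(2) by (intro conforms_signs_scale assms(3)) simp
  with conforms_trans[OF uX *(4)] have vY: "conforms (signs I l v) Y"
    unfolding v_def u_def by (rule conforms_signs_add)
  show "conforms (signs I l 0) X" "signs I l 0 \<noteq> X" using * by (auto simp: conforms_def)
  show "conforms (signs I l u) Y" "conforms (signs I l v) Z" using uX vY * conforms_trans by blast+
  show "signs I l u \<noteq> Y" using uX * unfolding conforms_def by metis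
  show "signs I l v \<noteq> Z" using vY * unfolding conforms_def by metis
qed

text \<open>On the closed cone of a flag the transfer exchanges the basis vectors and keeps the
  coordinates; in particular it is linear there.\<close>

lemma transfer_flag:
  assumes "is_flag I l h X Y Z" "0 \<le> a" "0 \<le> b" "0 \<le> c"
  shows "transfer (a \<odot> rep I l h X + b \<odot> rep I l h Y + c \<odot> rep I l h Z) =
    a \<odot> rep I l' h X + b \<odot> rep I l' h Y + c \<odot> rep I l' h Z"
proof (rule transfer_eqI)
  have c: "X \<in> covectors I l" "Y \<in> covectors I l" "Z \<in> covectors I l"
    using assms(1) unfolding is_flag_def by blast+
  note f = flag_below[OF assms(1-3)]
  have "link I h l l' (0 + a \<odot> rep I l h X) (0 + a \<odot> rep I l' h X)"
    by (rule link_step_ge[OF link.zero c(1) f(1,2) assms(2)])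
  then have "link I h l l' (a \<odot> rep I l h X) (a \<odot> rep I l' h X)" by simp
  from link_step_ge[OF link_step_ge[OF this c(2) f(3,4) assms(3)] c(3) f(5,6) assms(4)]
  show "link I h l l' (a \<odot> rep I l h X + b \<odot> rep I l h Y + c \<odot> rep I l h Z)
    (a \<odot> rep I l' h X + b \<odot> rep I l' h Y + c \<odot> rep I l' h Z)" .
qed

text \<open>With positive coefficients the cell, the edge and the vertex are recovered one after the
  other from the vector, so the open cones of distinct flags are disjoint.\<close>

lemma flag_unique:
  assumes "is_flag I l h X Y Z" "0 < a" "0 < b" "0 < c" and "is_flag I l h X' Y' Z'" "0 < a'" "0 < b'" "0 < c'"
    and "a \<odot> rep I l h X + b \<odot> rep I l h Y + c \<odot> rep I l h Z = a' \<odot> rep I l h X' + b' \<odot> rep I l h Y' + c' \<odot> rep I l h Z'"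
  shows "X = X' \<and> Y = Y' \<and> Z = Z'"
proof -
  have c: "X \<in> covectors I l" "Y \<in> covectors I l" "Z \<in> covectors I l" "X' \<in> covectors I l" "Y' \<in> covectors I l" "Z' \<in> covectors I l"
    using assms(1,5) unfolding is_flag_def by blast+
  note f = flag_below[OF assms(1) less_imp_le[OF assms(2)] less_imp_le[OF assms(3)]]
  note g = flag_below[OF assms(5) less_imp_le[OF assms(6)] less_imp_le[OF assms(7)]]
  have 1: "Z = Z' \<and> a \<odot> rep I l h X + b \<odot> rep I l h Y = a' \<odot> rep I l h X' + b' \<odot> rep I l h Y'"
    using decomposition_unique[OF assms(9)] c f g assms by blast
  then have 2: "Y = Y' \<and> a \<odot> rep I l h X = a' \<odot> rep I l h X'"
    using decomposition_unique[of "a \<odot> rep I l h X" b Y "a' \<odot> rep I l h X'" b' Y'] c f g assms by blast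
  then have "X = X'"
    using decomposition_unique[of 0 a X 0 a' X'] c f(1,2) g(1,2) assms by simp
  with 1 2 show ?thesis by blast
qed

end

section \<open>The transfer in the affine plane\<close>

definition homog :: "'a::linordered_field \<times> 'a \<Rightarrow> 'a vec3" where
  "homog p = Vec3 (fst p) (snd p) 1"

definition dehomog :: "'a vec3 \<Rightarrow> 'a \<times> 'a" where
  "dehomog p = (xcoord p, ycoord p)"

lemma dehomog_homog [simp]: "dehomog (homog p) = p"
  by (simp add: dehomog_def homog_def)

lemma homog_dehomog: "zcoord p = 1 \<Longrightarrow> homog (dehomog p) = p"
  by (cases p) (simp add: dehomog_def homog_def)

lemma homog_inject: "homog p = homog q \<Longrightarrow> p = q"
  by (metis dehomog_homog)

lemma dot_homog: "\<alpha> \<bullet> homog p = xcoord \<alpha> * fst p + ycoord \<alpha> * snd p + zcoord \<alpha>"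
  by (cases \<alpha>) (simp add: homog_def)

lemma dot_horizon: "Vec3 0 0 1 \<bullet> p = zcoord p"
  by (cases p) simp

section \<open>Polygonal pieces given by positivity of forms\<close>

lemma positive_near:
  assumes "finite \<Phi>" "\<forall>\<alpha>\<in>\<Phi>. 0 < \<alpha> \<bullet> homog p"
  obtains e where "0 < e" "\<And>q \<alpha>. \<lbrakk>\<alpha> \<in> \<Phi>; \<bar>fst q - fst p\<bar> < e; \<bar>snd q - snd p\<bar> < e\<rbrakk> \<Longrightarrow> 0 < \<alpha> \<bullet> homog q"
proof -
  have "\<exists>e>0. \<forall>\<alpha>\<in>\<Phi>. \<forall>q. \<bar>fst q - fst p\<bar> < e \<and> \<bar>snd q - snd p\<bar> < e \<longrightarrow> 0 < \<alpha> \<bullet> homog q"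
    using assms
  proof (induction \<Phi>)
    case empty
    show ?case by (auto intro: exI[of _ 1])
  next
    case (insert \<alpha> \<Phi>)
    then obtain e where e: "0 < e" "\<forall>\<alpha>\<in>\<Phi>. \<forall>q. \<bar>fst q - fst p\<bar> < e \<and> \<bar>snd q - snd p\<bar> < e \<longrightarrow> 0 < \<alpha> \<bullet> homog q"
      by auto
    define a b d where "a = xcoord \<alpha>" and "b = ycoord \<alpha>" and "d = \<alpha> \<bullet> homog p"
    \<comment> \<open>A Lipschitz constant of the form on the plane, increased by 1 so that it is
      positive and the estimate strict.\<close>
    define m where "m = \<bar>a\<bar> + \<bar>b\<bar> + 1"
    have m: "0 < m" by (simp add: m_def add_nonneg_pos)
    have "0 < d" using insert.prems by (simp add: d_def)
    have "0 < \<alpha> \<bullet> homog q" if q: "\<bar>fst q - fst p\<bar> < d / m" "\<bar>snd q - snd p\<bar> < d / m" for q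
    proof -
      have "\<bar>a * (fst q - fst p)\<bar> \<le> \<bar>a\<bar> * (d / m)" "\<bar>b * (snd q - snd p)\<bar> \<le> \<bar>b\<bar> * (d / m)"
        unfolding abs_mult by (intro mult_left_mono less_imp_le[OF q(1)] less_imp_le[OF q(2)] abs_ge_zero)+
      moreover have "\<bar>a\<bar> * (d / m) + \<bar>b\<bar> * (d / m) < m * (d / m)"
        using \<open>0 < d\<close> m mult_strict_right_mono[of "\<bar>a\<bar> + \<bar>b\<bar>" m "d / m"] by (simp only: m_def distrib_right) simp
      moreover have "m * (d / m) = d" using m by simp
      moreover have "\<alpha> \<bullet> homog q = d + a * (fst q - fst p) + b * (snd q - snd p)"
        by (simp add: d_def a_def b_def dot_homog algebra_simps)
      ultimately show ?thesis by linarith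
    qed
    moreover have "0 < d / m" using \<open>0 < d\<close> m by simp
    ultimately show ?case using e by (intro exI[of _ "min e (d / m)"]) auto
  qed
  then show ?thesis using that by blast
qed

lemma cone_piece:
  assumes "finite \<Phi>" and p0: "\<forall>\<alpha>\<in>\<Phi>. 0 < \<alpha> \<bullet> homog p0"
  defines "P \<equiv> {p. \<forall>\<alpha>\<in>\<Phi>. 0 \<le> \<alpha> \<bullet> homog p}"
  shows convex_polygonal_piece_cone: "convex_polygonal_piece P"
    and plane_interior_cone: "plane_interior P \<subseteq> {p. \<forall>\<alpha>\<in>\<Phi>. 0 < \<alpha> \<bullet> homog p}"
proof -
  define \<Psi> where "\<Psi> = {\<alpha>\<in>\<Phi>. xcoord \<alpha> \<noteq> 0 \<or> ycoord \<alpha> \<noteq> 0}"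
  have const: "0 < \<alpha> \<bullet> homog p" if "\<alpha> \<in> \<Phi>" "\<alpha> \<notin> \<Psi>" for \<alpha> p
    using p0 that by (auto simp: \<Psi>_def dot_homog)
  have "P = \<Inter> ((\<lambda>\<alpha>. {p. 0 \<le> \<alpha> \<bullet> homog p}) ` \<Psi>)"
    using less_imp_le[OF const] by (auto simp: P_def \<Psi>_def)
  moreover have "half_plane {p. 0 \<le> \<alpha> \<bullet> homog p}" if "\<alpha> \<in> \<Psi>" for \<alpha>
    unfolding half_plane_def
  proof (intro exI conjI)
    show "(- xcoord \<alpha>, - ycoord \<alpha>) \<noteq> (0, 0)" using that by (auto simp: \<Psi>_def)
    show "{p. 0 \<le> \<alpha> \<bullet> homog p} = {(x, y). - xcoord \<alpha> * x + - ycoord \<alpha> * y \<le> zcoord \<alpha>}"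
      by (auto simp: dot_homog algebra_simps)
  qed
  moreover have "finite \<Psi>" using assms(1) by (simp add: \<Psi>_def)
  moreover have "p0 \<in> plane_interior P"
  proof -
    obtain e where "0 < e" "\<And>q \<alpha>. \<lbrakk>\<alpha> \<in> \<Phi>; \<bar>fst q - fst p0\<bar> < e; \<bar>snd q - snd p0\<bar> < e\<rbrakk> \<Longrightarrow> 0 < \<alpha> \<bullet> homog q"
      using positive_near[OF assms(1) p0] by blast
    then show ?thesis
      unfolding plane_interior_def P_def by (simp only: mem_Collect_eq) (meson less_imp_le)
  qed
  ultimately show "convex_polygonal_piece P"
    unfolding convex_polygonal_piece_def by (intro conjI exI[of _ "(\<lambda>\<alpha>. {p. 0 \<le> \<alpha> \<bullet> homog p}) ` \<Psi>"]) auto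
  show "plane_interior P \<subseteq> {p. \<forall>\<alpha>\<in>\<Phi>. 0 < \<alpha> \<bullet> homog p}"
  proof (intro subsetI CollectI ballI)
    fix p \<alpha> assume p: "p \<in> plane_interior P" and \<alpha>: "\<alpha> \<in> \<Phi>"
    show "0 < \<alpha> \<bullet> homog p"
    proof (cases "\<alpha> \<in> \<Psi>")
      case True
      obtain e where e: "0 < e" "\<And>q. \<bar>fst q - fst p\<bar> < e \<and> \<bar>snd q - snd p\<bar> < e \<Longrightarrow> q \<in> P"
        using p unfolding plane_interior_def by blast
      define a b where "a = xcoord \<alpha>" and "b = ycoord \<alpha>"
      have bound: "\<bar>e / 2 * sgn c\<bar> < e" for c using e(1) by (simp add: abs_mult sgn_if)
      \<comment> \<open>The point is moved against the gradient: the form drops by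
        \<open>e / 2 * (\<bar>a\<bar> + \<bar>b\<bar>)\<close> and is still nonnegative, so it was
        positive.\<close>
      have "(fst p - e / 2 * sgn a, snd p - e / 2 * sgn b) \<in> P"
        by (rule e(2)) (use bound in auto)
      then have "0 \<le> a * (fst p - e / 2 * sgn a) + b * (snd p - e / 2 * sgn b) + zcoord \<alpha>"
        using \<alpha> by (simp add: P_def dot_homog a_def b_def)
      also have "\<dots> = \<alpha> \<bullet> homog p - e / 2 * (\<bar>a\<bar> + \<bar>b\<bar>)"
        by (simp add: dot_homog a_def b_def abs_sgn algebra_simps)
      finally have "e / 2 * (\<bar>a\<bar> + \<bar>b\<bar>) \<le> \<alpha> \<bullet> homog p" by simp
      moreover have "0 < \<bar>a\<bar> + \<bar>b\<bar>"
        using True by (auto simp: \<Psi>_def a_def b_def add_pos_nonneg add_nonneg_pos)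
      then have "0 < e / 2 * (\<bar>a\<bar> + \<bar>b\<bar>)" using e(1) by simp
      ultimately show ?thesis by (rule order_less_le_trans[rotated])
    next
      case False
      show ?thesis by (rule const[OF \<alpha> False])
    qed
  qed
qed

lemma affine_map_dehomog:
  "affine_map (\<lambda>p. dehomog ((\<alpha> \<bullet> homog p) \<odot> u + (\<beta> \<bullet> homog p) \<odot> v + (\<gamma> \<bullet> homog p) \<odot> w))"
proof -
  obtain a1 a2 a3 b1 b2 b3 c1 c2 c3 where "\<alpha> = Vec3 a1 a2 a3" "\<beta> = Vec3 b1 b2 b3" "\<gamma> = Vec3 c1 c2 c3"
    by (cases \<alpha>; cases \<beta>; cases \<gamma>)
  moreover obtain u1 u2 u3 v1 v2 v3 w1 w2 w3 where "u = Vec3 u1 u2 u3" "v = Vec3 v1 v2 v3" "w = Vec3 w1 w2 w3"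
    by (cases u; cases v; cases w)
  ultimately show ?thesis
    unfolding affine_map_def
    by - (rule exI[of _ "a1 * u1 + b1 * v1 + c1 * w1"], rule exI[of _ "a2 * u1 + b2 * v1 + c2 * w1"],
        rule exI[of _ "a1 * u2 + b1 * v2 + c1 * w2"], rule exI[of _ "a2 * u2 + b2 * v2 + c2 * w2"],
        rule exI[of _ "a3 * u1 + b3 * v1 + c3 * w1"], rule exI[of _ "a3 * u2 + b3 * v2 + c3 * w2"],
        simp add: homog_def dehomog_def algebra_simps)
qed

lemma finite_covectors:
  fixes l :: "'i \<Rightarrow> 'a::linordered_field vec3"
  assumes "finite I" shows "finite (covectors I l)"
proof (rule finite_subset)
  have s: "sgn x \<in> {-1, 0, 1}" for x :: 'a by (simp add: sgn_if)
  show "covectors I l \<subseteq> {X. \<forall>i. (i \<in> I \<longrightarrow> X i \<in> {-1, 0, 1}) \<and> (i \<notin> I \<longrightarrow> X i = 0)}"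
    using s by (simp add: covectors_def signs_def image_subset_iff)
  show "finite {X. \<forall>i. (i \<in> I \<longrightarrow> X i \<in> {-1, 0, 1}) \<and> (i \<notin> I \<longrightarrow> X i = (0::'a))}"
    using assms by (intro finite_set_of_finite_funs) auto
qed

text \<open>The slice \<open>z = 1\<close> of the cone of a flag: a triangle, or an unbounded region
  if the vertex or the edge representative lies at infinity.\<close>

definition flag_piece :: "'i set \<Rightarrow> ('i \<Rightarrow> 'a::linordered_field vec3) \<Rightarrow> 'i \<Rightarrow> ('i \<Rightarrow> 'a) \<Rightarrow> ('i \<Rightarrow> 'a) \<Rightarrow> ('i \<Rightarrow> 'a) \<Rightarrow> ('a \<times> 'a) set" where
  "flag_piece I l h X Y Z = {p. \<exists>a b c. 0 \<le> a \<and> 0 \<le> b \<and> 0 \<le> c \<and>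
     homog p = a \<odot> rep I l h X + b \<odot> rep I l h Y + c \<odot> rep I l h Z}"

locale affine_configuration_pair = configuration_pair I l l' h
  for I :: "'i set" and l l' :: "'i \<Rightarrow> 'a::linordered_field vec3" and h +
  assumes horizon: "l h = Vec3 0 0 1" "l' h = Vec3 0 0 1"
begin

lemma swap_affine: "affine_configuration_pair I l' l h"
  using swap horizon by (simp add: affine_configuration_pair_def affine_configuration_pair_axioms_def)

lemma flag_piece_cone:
  assumes "is_flag I l h X Y Z"
  obtains \<Phi> p0 where "finite \<Phi>" "\<forall>\<alpha>\<in>\<Phi>. 0 < \<alpha> \<bullet> homog p0"
    "flag_piece I l h X Y Z = {p. \<forall>\<alpha>\<in>\<Phi>. 0 \<le> \<alpha> \<bullet> homog p}"
    "\<And>p. \<forall>\<alpha>\<in>\<Phi>. 0 < \<alpha> \<bullet> homog p \<Longrightarrow> \<exists>a b c. 0 < a \<and> 0 < b \<and> 0 < c \<and>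
       homog p = a \<odot> rep I l h X + b \<odot> rep I l h Y + c \<odot> rep I l h Z"
proof -
  define u v w where "u = rep I l h X" and "v = rep I l h Y" and "w = rep I l h Z"
  obtain \<alpha> \<beta> \<gamma> where
    sum: "\<And>p. p = (\<alpha> \<bullet> p) \<odot> u + (\<beta> \<bullet> p) \<odot> v + (\<gamma> \<bullet> p) \<odot> w"
    and coeff: "\<And>a b c. \<alpha> \<bullet> (a \<odot> u + b \<odot> v + c \<odot> w) = a" "\<And>a b c. \<beta> \<bullet> (a \<odot> u + b \<odot> v + c \<odot> w) = b"
      "\<And>a b c. \<gamma> \<bullet> (a \<odot> u + b \<odot> v + c \<odot> w) = c"
    unfolding u_def v_def w_def using A.flag_dual[OF h_in assms] by metis
  have *: "X \<in> covectors I l" "Y \<in> covectors I l" "Z \<in> covectors I l" "conforms X Y" "conforms Y Z" "Z h = 1"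
    using assms unfolding is_flag_def by blast+
  \<comment> \<open>The \<open>z\<close>-coordinate of the sum of the representatives. It is at
    least 1, since \<open>X\<close> and \<open>Y\<close> conform to \<open>Z\<close> and
    \<open>Z h = 1\<close>; dividing by it gives a point \<open>p0\<close> of the slice with three
    equal positive coefficients.\<close>
  define s where "s = X h + Y h + 1"
  have "X h \<in> {0, 1}" "Y h \<in> {0, 1}" using *(4-6) unfolding conforms_def by (metis insert_iff)+
  then have "0 < s" by (auto simp: s_def)
  have "zcoord (u + v + w) = s"
    using dot_rep[OF *(1) h_in] dot_rep[OF *(2) h_in] dot_rep[OF *(3) h_in] *(6)
    by (simp add: u_def v_def w_def s_def horizon flip: dot_horizon)
  define p0 where "p0 = dehomog ((1 / s) \<odot> u + (1 / s) \<odot> v + (1 / s) \<odot> w)"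
  have p0: "homog p0 = (1 / s) \<odot> u + (1 / s) \<odot> v + (1 / s) \<odot> w"
    unfolding p0_def using \<open>zcoord (u + v + w) = s\<close> \<open>0 < s\<close>
    by (intro homog_dehomog) (simp flip: scale_right_distrib)
  show ?thesis
  proof (rule that[of "{\<alpha>, \<beta>, \<gamma>}" p0])
    show "\<forall>\<delta>\<in>{\<alpha>, \<beta>, \<gamma>}. 0 < \<delta> \<bullet> homog p0"
      unfolding p0 using \<open>0 < s\<close> by (simp only: ball_simps coeff) simp
    show "flag_piece I l h X Y Z = {p. \<forall>\<alpha>\<in>{\<alpha>, \<beta>, \<gamma>}. 0 \<le> \<alpha> \<bullet> homog p}"
    proof (intro equalityI subsetI)
      fix p assume "p \<in> flag_piece I l h X Y Z"
      then obtain a b c where "0 \<le> a" "0 \<le> b" "0 \<le> c" "homog p = a \<odot> u + b \<odot> v + c \<odot> w"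
        unfolding flag_piece_def u_def v_def w_def by blast
      then show "p \<in> {p. \<forall>\<alpha>\<in>{\<alpha>, \<beta>, \<gamma>}. 0 \<le> \<alpha> \<bullet> homog p}" using coeff by simp
    next
      fix p assume "p \<in> {p. \<forall>\<alpha>\<in>{\<alpha>, \<beta>, \<gamma>}. 0 \<le> \<alpha> \<bullet> homog p}"
      then show "p \<in> flag_piece I l h X Y Z"
        unfolding flag_piece_def using sum[of "homog p", unfolded u_def v_def w_def] by blast
    qed
    show "\<exists>a b c. 0 < a \<and> 0 < b \<and> 0 < c \<and> homog p = a \<odot> rep I l h X + b \<odot> rep I l h Y + c \<odot> rep I l h Z"
      if "\<forall>\<delta>\<in>{\<alpha>, \<beta>, \<gamma>}. 0 < \<delta> \<bullet> homog p" for p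
      using that sum[of "homog p", unfolded u_def v_def w_def] by blast
  qed simp
qed

definition flag_pieces :: "('a \<times> 'a) set set" where
  "flag_pieces = {flag_piece I l h X Y Z |X Y Z. is_flag I l h X Y Z}"

lemma polygonal_decomposition_flag_pieces: "polygonal_decomposition flag_pieces"
  unfolding polygonal_decomposition_def
proof (intro conjI ballI impI)
  let ?C = "covectors I l"
  have "flag_pieces \<subseteq> (\<lambda>(X, Y, Z). flag_piece I l h X Y Z) ` (?C \<times> ?C \<times> ?C)"
    by (force simp: flag_pieces_def is_flag_def)
  then show "finite flag_pieces"
    by (rule finite_subset) (simp add: finite_covectors A.finite_I)
next
  fix P assume "P \<in> flag_pieces"
  then obtain X Y Z where P: "P = flag_piece I l h X Y Z" "is_flag I l h X Y Z"
    unfolding flag_pieces_def by blast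
  show "convex_polygonal_piece P"
    by (rule flag_piece_cone[OF P(2)]) (simp only: P(1) convex_polygonal_piece_cone)
next
  have "p \<in> \<Union> flag_pieces" for p
  proof -
    have "0 < l h \<bullet> homog p" by (simp add: horizon dot_homog)
    then show ?thesis
      by (rule A.flag_cover[OF h_in]) (auto simp: flag_pieces_def flag_piece_def)
  qed
  then show "\<Union> flag_pieces = UNIV" by blast
next
  fix P Q assume "P \<in> flag_pieces" "Q \<in> flag_pieces" "P \<noteq> Q"
  then obtain X Y Z X' Y' Z' where P: "P = flag_piece I l h X Y Z" "is_flag I l h X Y Z"
      and Q: "Q = flag_piece I l h X' Y' Z'" "is_flag I l h X' Y' Z'"
    unfolding flag_pieces_def by blast
  have pos: "\<exists>a b c. 0 < a \<and> 0 < b \<and> 0 < c \<and> homog p = a \<odot> rep I l h X + b \<odot> rep I l h Y + c \<odot> rep I l h Z"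
    if F: "is_flag I l h X Y Z" and p: "p \<in> plane_interior (flag_piece I l h X Y Z)" for X Y Z p
  proof -
    obtain \<Phi> p0 where *: "finite \<Phi>" "\<forall>\<alpha>\<in>\<Phi>. 0 < \<alpha> \<bullet> homog p0"
    "flag_piece I l h X Y Z = {p. \<forall>\<alpha>\<in>\<Phi>. 0 \<le> \<alpha> \<bullet> homog p}"
    "\<And>p. \<forall>\<alpha>\<in>\<Phi>. 0 < \<alpha> \<bullet> homog p \<Longrightarrow> \<exists>a b c. 0 < a \<and> 0 < b \<and> 0 < c \<and>
       homog p = a \<odot> rep I l h X + b \<odot> rep I l h Y + c \<odot> rep I l h Z"
      by (rule flag_piece_cone[OF F]) (rule that)
    from p have "\<forall>\<alpha>\<in>\<Phi>. 0 < \<alpha> \<bullet> homog p"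
      using plane_interior_cone[OF *(1,2)] unfolding *(3) by blast
    then show ?thesis by (rule *(4))
  qed
  show "plane_interior P \<inter> plane_interior Q = {}"
  proof (rule ccontr)
    assume "plane_interior P \<inter> plane_interior Q \<noteq> {}"
    then obtain p where "p \<in> plane_interior P" "p \<in> plane_interior Q" by blast
    then obtain a b c a' b' c' where abc: "0 < a" "0 < b" "0 < c" "0 < a'" "0 < b'" "0 < c'"
      and "homog p = a \<odot> rep I l h X + b \<odot> rep I l h Y + c \<odot> rep I l h Z"
        "homog p = a' \<odot> rep I l h X' + b' \<odot> rep I l h Y' + c' \<odot> rep I l h Z'"
      using pos[OF P(2), of p] pos[OF Q(2), of p] P(1) Q(1) by blast
    then have "X = X' \<and> Y = Y' \<and> Z = Z'"
      by (intro flag_unique[OF P(2) abc(1-3) Q(2) abc(4-6)]) simp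
    then show False using \<open>P \<noteq> Q\<close> P Q by blast
  qed
qed

definition plane_transfer :: "'a \<times> 'a \<Rightarrow> 'a \<times> 'a" where
  "plane_transfer p = dehomog (transfer (homog p))"

lemma homog_plane_transfer: "homog (plane_transfer p) = transfer (homog p)"
  unfolding plane_transfer_def
  using transfer_signs(2)[of "homog p"] by (intro homog_dehomog) (simp add: horizon dot_horizon homog_def)

lemma plane_transfer_swap: "affine_configuration_pair.plane_transfer I l' l h (plane_transfer p) = p"
  using affine_configuration_pair.plane_transfer_def[OF swap_affine] homog_plane_transfer transfer_swap
  by simp

lemma plane_transfer_line: "i \<in> I \<Longrightarrow> l' i \<bullet> homog (plane_transfer p) = 0 \<longleftrightarrow> l i \<bullet> homog p = 0"
  using transfer_signs(1)[of "homog p"] A.signs_zero_iff B.signs_zero_iff homog_plane_transfer by metis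

lemma pl_automorphism_plane_transfer: "pl_automorphism plane_transfer"
  unfolding pl_automorphism_def
proof (intro conjI exI[of _ flag_pieces] ballI)
  show "bij plane_transfer"
    by (rule bij_betw_byWitness[where f' = "affine_configuration_pair.plane_transfer I l' l h"])
      (auto simp: plane_transfer_swap affine_configuration_pair.plane_transfer_swap[OF swap_affine])
  show "polygonal_decomposition flag_pieces" by (rule polygonal_decomposition_flag_pieces)
  fix P assume "P \<in> flag_pieces"
  then obtain X Y Z where P: "P = flag_piece I l h X Y Z" "is_flag I l h X Y Z"
    unfolding flag_pieces_def by blast
  obtain \<alpha> \<beta> \<gamma> where
    coeff: "\<And>a b c. \<alpha> \<bullet> (a \<odot> rep I l h X + b \<odot> rep I l h Y + c \<odot> rep I l h Z) = a"
      "\<And>a b c. \<beta> \<bullet> (a \<odot> rep I l h X + b \<odot> rep I l h Y + c \<odot> rep I l h Z) = b"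
      "\<And>a b c. \<gamma> \<bullet> (a \<odot> rep I l h X + b \<odot> rep I l h Y + c \<odot> rep I l h Z) = c"
    using A.flag_dual[OF h_in P(2)] by metis
  show "\<exists>g. affine_map g \<and> (\<forall>p\<in>P. plane_transfer p = g p)"
  proof (intro exI conjI ballI)
    show "affine_map (\<lambda>p. dehomog ((\<alpha> \<bullet> homog p) \<odot> rep I l' h X + (\<beta> \<bullet> homog p) \<odot> rep I l' h Y + (\<gamma> \<bullet> homog p) \<odot> rep I l' h Z))"
      by (rule affine_map_dehomog)
    fix p assume "p \<in> P"
    then obtain a b c where abc: "0 \<le> a" "0 \<le> b" "0 \<le> c" "homog p = a \<odot> rep I l h X + b \<odot> rep I l h Y + c \<odot> rep I l h Z"
      unfolding P flag_piece_def by blast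
    show "plane_transfer p = dehomog ((\<alpha> \<bullet> homog p) \<odot> rep I l' h X + (\<beta> \<bullet> homog p) \<odot> rep I l' h Y + (\<gamma> \<bullet> homog p) \<odot> rep I l' h Z)"
      unfolding plane_transfer_def abc(4) coeff transfer_flag[OF P(2) abc(1-3)] ..
  qed
qed

end

theorem pl_automorphism_of_same_orientations:
  assumes "vector_configuration I l" "vector_configuration I l'" "h \<in> I" "l h = Vec3 0 0 1" "l' h = Vec3 0 0 1"
    and same: "\<And>i j k. \<lbrakk>i \<in> I; j \<in> I; k \<in> I; i \<noteq> j; i \<noteq> k; j \<noteq> k\<rbrakk> \<Longrightarrow>
      sgn (det3 (l i) (l j) (l k)) = sgn (det3 (l' i) (l' j) (l' k))"
  obtains f where "pl_automorphism f" "\<And>i. i \<in> I \<Longrightarrow> f ` {p. l i \<bullet> homog p = 0} = {p. l' i \<bullet> homog p = 0}"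
proof -
  interpret A: vector_configuration I l by fact
  interpret B: vector_configuration I l' by fact
  have "covectors I l = covectors I l'"
  proof
    show "covectors I l \<subseteq> covectors I l'" by (rule covectors_subset[OF assms(1,2) same])
    show "covectors I l' \<subseteq> covectors I l" by (rule covectors_subset[OF assms(2,1) same[symmetric]])
  qed
  then interpret affine_configuration_pair I l l' h
    using assms by unfold_locales
  show ?thesis
  proof (rule that[OF pl_automorphism_plane_transfer])
    fix i assume i: "i \<in> I"
    show "plane_transfer ` {p. l i \<bullet> homog p = 0} = {p. l' i \<bullet> homog p = 0}"
    proof (intro equalityI subsetI)
      fix q assume q: "q \<in> {p. l' i \<bullet> homog p = 0}"
      define p where "p = affine_configuration_pair.plane_transfer I l' l h q"
      have "plane_transfer p = q"
        unfolding p_def by (rule affine_configuration_pair.plane_transfer_swap[OF swap_affine])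
      then show "q \<in> plane_transfer ` {p. l i \<bullet> homog p = 0}"
        using q plane_transfer_line[OF i, of p] by blast
    next
      fix q assume "q \<in> plane_transfer ` {p. l i \<bullet> homog p = 0}"
      then show "q \<in> {p. l' i \<bullet> homog p = 0}" using plane_transfer_line[OF i] by blast
    qed
  qed
qed

section \<open>Betweenness under piecewise linear automorphisms\<close>

definition along :: "'a::linordered_field \<times> 'a \<Rightarrow> 'a \<times> 'a \<Rightarrow> 'a \<Rightarrow> 'a \<times> 'a" where
  "along q r t = ((1 - t) * fst q + t * fst r, (1 - t) * snd q + t * snd r)"

lemma strictly_between_along:
  "strictly_between q p r \<longleftrightarrow> q \<noteq> r \<and> (\<exists>t. 0 < t \<and> t < 1 \<and> p = along q r t)"
  by (simp add: strictly_between_def along_def)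

lemma along_0 [simp]: "along q r 0 = q" and along_1 [simp]: "along q r 1 = r"
  by (simp_all add: along_def)

lemma along_inject:
  assumes "q \<noteq> r" "along q r s = along q r t"
  shows "s = t"
proof -
  have "(s - t) * (fst r - fst q) = 0" "(s - t) * (snd r - snd q) = 0"
    using assms(2) by (auto simp: along_def algebra_simps)
  then show ?thesis using assms(1) by (auto simp: prod_eq_iff)
qed

lemma strictly_between_sym: "strictly_between q p r \<Longrightarrow> strictly_between r p q"
proof -
  assume "strictly_between q p r"
  then obtain t where "q \<noteq> r" "0 < t" "t < 1" "p = along q r t" by (auto simp: strictly_between_along)
  then show "strictly_between r p q"
    unfolding strictly_between_along by (intro conjI exI[of _ "1 - t"]) (auto simp: along_def algebra_simps)
qed

lemma strictly_between_neq:
  assumes "strictly_between q p r" shows "p \<noteq> q" "p \<noteq> r"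
proof -
  obtain t where t: "q \<noteq> r" "0 < t" "t < 1" "p = along q r t" using assms by (auto simp: strictly_between_along)
  show "p \<noteq> q" using along_inject[OF t(1), of t 0] t by auto
  show "p \<noteq> r" using along_inject[OF t(1), of t 1] t by auto
qed

lemma homog_along: "homog (along q r t) = (1 - t) \<odot> homog q + t \<odot> homog r"
  by (simp add: homog_def along_def)

lemma dot_along: "\<alpha> \<bullet> homog (along q r t) = (1 - t) * (\<alpha> \<bullet> homog q) + t * (\<alpha> \<bullet> homog r)"
  by (simp add: homog_along)

text \<open>Continuity alone does not give intermediate values over an ordered field. Here they
  follow by splitting at breakpoints, by induction on their number, until one linear equation
  remains.\<close>

lemma piecewise_affine_ivt:
  fixes g :: "'a::linordered_field \<Rightarrow> 'a"
  assumes "finite B"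
    and affine: "\<And>s e. s < e \<Longrightarrow> B \<inter> {s<..<e} = {} \<Longrightarrow> \<exists>m k. \<forall>t\<in>{s..e}. g t = m * t + k"
    and "s \<le> e" "v \<in> {min (g s) (g e)..max (g s) (g e)}"
  shows "\<exists>t\<in>{s..e}. g t = v"
  using assms(3,4)
proof (induction "card (B \<inter> {s<..<e})" arbitrary: s e rule: less_induct)
  case less
  show ?case
  proof (cases "s < e \<and> B \<inter> {s<..<e} \<noteq> {}")
    case True
    then obtain b where b: "b \<in> B" "s < b" "b < e" by auto
    have "card (B \<inter> {s<..<b}) < card (B \<inter> {s<..<e})" "card (B \<inter> {b<..<e}) < card (B \<inter> {s<..<e})"
      using b assms(1) by (auto intro!: psubset_card_mono)
    \<comment> \<open>Whatever \<open>g b\<close> is, a value between \<open>g s\<close> and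
      \<open>g e\<close> lies between \<open>g b\<close> and one of them. The halves share the point
      \<open>b\<close>, so no separate continuity argument arises.\<close>
    moreover have "v \<in> {min (g s) (g b)..max (g s) (g b)} \<or> v \<in> {min (g b) (g e)..max (g b) (g e)}"
      using less.prems(2) by (auto simp: min_def max_def split: if_splits)
    ultimately consider "\<exists>t\<in>{s..b}. g t = v" | "\<exists>t\<in>{b..e}. g t = v"
      using less.hyps[of s b] less.hyps[of b e] b by fastforce
    then show ?thesis using b by cases (auto intro: less_imp_le order_trans)
  next
    case no_break: False
    show ?thesis
    proof (cases "g s = g e \<or> s = e")
      case True
      then show ?thesis using less.prems by (intro bexI[of _ s]) auto
    next
      case False
      then have "s < e" using less.prems by auto
      then obtain m k where mk: "\<And>t. t \<in> {s..e} \<Longrightarrow> g t = m * t + k" using affine no_break by blast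
      have gs: "g s = m * s + k" and ge: "g e = m * e + k" using mk \<open>s < e\<close> by auto
      then have "m \<noteq> 0" using False by auto
      define t where "t = (v - k) / m"
      have v: "v = m * t + k" using \<open>m \<noteq> 0\<close> by (simp add: t_def)
      have "t \<in> {s..e}"
      proof (cases "0 < m")
        case True
        then show ?thesis using less.prems(2) \<open>s < e\<close> unfolding gs ge v by (auto simp: min_def max_def split: if_splits)
      next
        case False
        then have "m < 0" using \<open>m \<noteq> 0\<close> by simp
        then show ?thesis using less.prems(2) \<open>s < e\<close> unfolding gs ge v by (auto simp: min_def max_def split: if_splits)
      qed
      then show ?thesis using mk[of t] v by (intro bexI[of _ t]) simp
    qed
  qed
qed

text \<open>If \<open>g t\<close> were not in the middle, the value at one end would lie between
  \<open>g t\<close> and the value at the other end and would be attained a second time.\<close>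

lemma injective_between:
  fixes g :: "'a::linordered_field \<Rightarrow> 'a"
  assumes inj: "inj g" and t: "0 < t" "t < 1"
    and ivt: "\<And>s e v. s \<le> e \<Longrightarrow> v \<in> {min (g s) (g e)..max (g s) (g e)} \<Longrightarrow> \<exists>t\<in>{s..e}. g t = v"
  shows "g 0 < g t \<and> g t < g 1 \<or> g 1 < g t \<and> g t < g 0"
proof (rule ccontr)
  assume not_between: "\<not> ?thesis"
  have ne: "g 0 \<noteq> g t" "g t \<noteq> g 1" "g 0 \<noteq> g 1" using inj t by (auto simp: inj_eq)
  then consider "g 1 \<in> {min (g 0) (g t)..max (g 0) (g t)}" | "g 0 \<in> {min (g t) (g 1)..max (g t) (g 1)}"
    using not_between
    by (cases "g 0 < g 1"; cases "g t < g 1"; cases "g t < g 0") (auto simp: min_def max_def)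
  then show False
  proof cases
    case 1
    then obtain x where "x \<in> {0..t}" "g x = g 1" using ivt[OF less_imp_le[OF t(1)]] by blast
    then show False using inj t by (auto simp: inj_eq)
  next
    case 2
    then obtain x where "x \<in> {t..1}" "g x = g 0" using ivt[OF less_imp_le[OF t(2)]] by blast
    then show False using inj t by (auto simp: inj_eq)
  qed
qed

text \<open>On a line a half-plane is a condition \<open>m * t \<le> k\<close>, which changes its
  truth value only at \<open>k / m\<close>. An interval without this point in its interior therefore
  lies in the half-plane as soon as its midpoint does.\<close>

lemma half_plane_breakpoint:
  assumes "half_plane H"
  shows "\<exists>b. \<forall>s e t. s < e \<and> \<not> (s < b \<and> b < e) \<and> along q r ((s + e) / 2) \<in> H \<and> s \<le> t \<and> t \<le> e \<longrightarrow> along q r t \<in> H"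
proof -
  obtain a b c where H: "H = {(x, y). a * x + b * y \<le> c}" using assms unfolding half_plane_def by blast
  define m where "m = a * (fst r - fst q) + b * (snd r - snd q)"
  define k where "k = c - a * fst q - b * snd q"
  have mem: "along q r t \<in> H \<longleftrightarrow> m * t \<le> k" for t
    by (simp add: H along_def m_def k_def algebra_simps)
  show ?thesis
  \<comment> \<open>For \<open>m = 0\<close> the quotient is 0, a harmless breakpoint, because
    membership is then constant along the line.\<close>
  proof (intro exI[of _ "k / m"] allI impI)
    fix s e t
    assume *: "s < e \<and> \<not> (s < k / m \<and> k / m < e) \<and> along q r ((s + e) / 2) \<in> H \<and> s \<le> t \<and> t \<le> e"
    have mid: "s < (s + e) / 2" "(s + e) / 2 < e" using * by auto
    have le: "m * ((s + e) / 2) \<le> k" using * mem by blast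
    show "along q r t \<in> H"
    proof (cases rule: linorder_cases[of m 0])
      case equal
      then show ?thesis using le mem by simp
    next
      case less
      then have "k / m \<le> (s + e) / 2" using le by (simp add: divide_le_eq mult.commute)
      then have "k / m \<le> t" using * mid by auto
      then show ?thesis using less mem by (simp add: divide_le_eq mult.commute)
    next
      case greater
      then have "(s + e) / 2 \<le> k / m" using le by (simp add: le_divide_eq mult.commute)
      then have "t \<le> k / m" using * mid by auto
      then show ?thesis using greater mem by (simp add: le_divide_eq mult.commute)
    qed
  qed
qed

text \<open>An interval free of breakpoints of all bounding half-planes stays in the piece that
  contains its midpoint.\<close>

lemma pl_automorphism_breakpoints:
  fixes f :: "'a::linordered_field \<times> 'a \<Rightarrow> 'a \<times> 'a"
  assumes "pl_automorphism f"
  obtains B where "finite B"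
    "\<And>s e. s < e \<Longrightarrow> B \<inter> {s<..<e} = {} \<Longrightarrow> \<exists>g. affine_map g \<and> (\<forall>t\<in>{s..e}. f (along q r t) = g (along q r t))"
proof -
  obtain D where D: "polygonal_decomposition D" and aff: "\<And>P. P \<in> D \<Longrightarrow> \<exists>g. affine_map g \<and> (\<forall>p\<in>P. f p = g p)"
    using assms unfolding pl_automorphism_def by blast
  have "\<forall>P\<in>D. \<exists>\<H>. finite \<H> \<and> (\<forall>H\<in>\<H>. half_plane H) \<and> P = \<Inter>\<H>"
    using D unfolding polygonal_decomposition_def convex_polygonal_piece_def by blast
  then obtain \<H> where H: "\<And>P. P \<in> D \<Longrightarrow> finite (\<H> P)" "\<And>P H. P \<in> D \<Longrightarrow> H \<in> \<H> P \<Longrightarrow> half_plane H" "\<And>P. P \<in> D \<Longrightarrow> P = \<Inter>(\<H> P)"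
    by metis
  have "\<forall>H. \<exists>b. half_plane H \<longrightarrow> (\<forall>s e t. s < e \<and> \<not> (s < b \<and> b < e) \<and> along q r ((s + e) / 2) \<in> H \<and> s \<le> t \<and> t \<le> e \<longrightarrow> along q r t \<in> H)"
    using half_plane_breakpoint by blast
  then obtain b where b: "\<And>H s e t. \<lbrakk>half_plane H; s < e; \<not> (s < b H \<and> b H < e); along q r ((s + e) / 2) \<in> H; s \<le> t; t \<le> e\<rbrakk> \<Longrightarrow> along q r t \<in> H"
    by metis
  define B where "B = (\<Union>P\<in>D. b ` \<H> P)"
  show ?thesis
  proof (rule that[of B])
    show "finite B" using D H(1) by (auto simp: B_def polygonal_decomposition_def)
    fix s e :: 'a assume "s < e" and B: "B \<inter> {s<..<e} = {}"
    have "along q r ((s + e) / 2) \<in> \<Union>D" using D by (simp add: polygonal_decomposition_def)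
    then obtain P where P: "P \<in> D" "along q r ((s + e) / 2) \<in> P" by blast
    have "along q r t \<in> P" if "t \<in> {s..e}" for t
    proof -
      have "along q r t \<in> X" if X: "X \<in> \<H> P" for X
      proof -
        have "b X \<in> B" using X P(1) by (auto simp: B_def)
        then have "\<not> (s < b X \<and> b X < e)" using B by auto
        moreover have "along q r ((s + e) / 2) \<in> X" using P(2) H(3)[OF P(1)] X by blast
        ultimately show ?thesis using b[OF H(2)[OF P(1) X] \<open>s < e\<close>] \<open>t \<in> {s..e}\<close> by auto
      qed
      then show ?thesis using H(3)[OF P(1)] by blast
    qed
    then show "\<exists>g. affine_map g \<and> (\<forall>t\<in>{s..e}. f (along q r t) = g (along q r t))"
      using aff[OF P(1)] by blast
  qed
qed

text \<open>The coordinate \<open>u\<close> along the image line makes the restriction of \<open>f\<close> an injective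
  piecewise affine function of one variable, which has the intermediate value property.\<close>

lemma pl_automorphism_between:
  fixes f :: "'a::linordered_field \<times> 'a \<Rightarrow> 'a \<times> 'a"
  assumes f: "pl_automorphism f" and K: "is_line K" and img: "\<And>t. f (along q r t) \<in> K"
    and pq: "strictly_between q p r"
  shows "strictly_between (f q) (f p) (f r)"
proof -
  obtain a b c where abc: "(a, b) \<noteq> (0, 0)" "K = {(x, y). a * x + b * y = c}"
    using K unfolding is_line_def by blast
  define u where "u p = b * fst p - a * snd p" for p :: "'a \<times> 'a"
  have sq: "a * a + b * b \<noteq> 0" using abc(1) by (simp add: add_nonneg_eq_0_iff)
  have u_inj: "x = y" if "x \<in> K" "y \<in> K" "u x = u y" for x y
  proof -
    define d e where "d = fst x - fst y" and "e = snd x - snd y"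
    have 1: "a * d + b * e = 0" "b * d - a * e = 0"
      using that abc(2) by (auto simp: u_def d_def e_def algebra_simps split: prod.splits)
    \<comment> \<open>The equation of the line and the coordinate \<open>u\<close> form a linear
      system with determinant \<open>- (a * a + b * b)\<close>, nonzero in an ordered field.\<close>
    have "(a * a + b * b) * d = a * (a * d + b * e) + b * (b * d - a * e)"
      "(a * a + b * b) * e = b * (a * d + b * e) - a * (b * d - a * e)" by (simp_all add: algebra_simps)
    then have "d = 0" "e = 0" using sq unfolding 1 by simp_all
    then show ?thesis by (simp add: d_def e_def prod_eq_iff)
  qed
  obtain t where t: "0 < t" "t < 1" "p = along q r t" and "q \<noteq> r" using pq strictly_between_along by metis
  define g where "g t = u (f (along q r t))" for t
  have "inj f" using f by (simp add: pl_automorphism_def bij_is_inj)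
  have "inj g"
  proof (rule injI)
    fix x y assume "g x = g y"
    then have "f (along q r x) = f (along q r y)" using u_inj img by (simp add: g_def)
    then show "x = y" using along_inject[OF \<open>q \<noteq> r\<close>] \<open>inj f\<close> by (simp add: inj_eq)
  qed
  obtain B where B: "finite B" "\<And>s e. s < e \<Longrightarrow> B \<inter> {s<..<e} = {} \<Longrightarrow> \<exists>g. affine_map g \<and> (\<forall>t\<in>{s..e}. f (along q r t) = g (along q r t))"
    using pl_automorphism_breakpoints[OF f, of q r] by metis
  have "\<exists>m k. \<forall>t\<in>{s..e}. g t = m * t + k" if se: "s < e" "B \<inter> {s<..<e} = {}" for s e
  proof -
    obtain h where h: "affine_map h" "\<And>t. t \<in> {s..e} \<Longrightarrow> f (along q r t) = h (along q r t)" using B(2)[OF se] by blast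
    obtain a' b' c' d' v w where h': "\<And>x y. h (x, y) = (a' * x + b' * y + v, c' * x + d' * y + w)"
      using h(1) unfolding affine_map_def by blast
    define m k where "m = (b * a' - a * c') * (fst r - fst q) + (b * b' - a * d') * (snd r - snd q)"
      and "k = (b * a' - a * c') * fst q + (b * b' - a * d') * snd q + b * v - a * w"
    have "g t = m * t + k" if "t \<in> {s..e}" for t
      unfolding g_def h(2)[OF that] by (simp add: along_def h' u_def m_def k_def algebra_simps)
    then show ?thesis by blast
  qed
  then have ivt: "\<exists>t\<in>{s..e}. g t = v" if "s \<le> e" "v \<in> {min (g s) (g e)..max (g s) (g e)}" for s e v
    using piecewise_affine_ivt[OF B(1) _ that] by blast
  have between: "g 0 < g t \<and> g t < g 1 \<or> g 1 < g t \<and> g t < g 0"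
    by (rule injective_between[OF \<open>inj g\<close> t(1,2) ivt])
  \<comment> \<open>The ratio in which the coordinate of \<open>f p\<close> divides those of
    \<open>f q\<close> and \<open>f r\<close>.\<close>
  define s where "s = (g t - g 0) / (g 1 - g 0)"
  have s: "0 < s" "s < 1" using between by (auto simp: s_def field_simps)
  have K_affine: "along x y s \<in> K" if "x \<in> K" "y \<in> K" for x y
  proof -
    have xy: "a * fst x + b * snd x = c" "a * fst y + b * snd y = c"
      using that abc(2) by (auto split: prod.splits)
    have "a * fst (along x y s) + b * snd (along x y s) = (1 - s) * (a * fst x + b * snd x) + s * (a * fst y + b * snd y)"
      by (simp add: along_def algebra_simps)
    also have "\<dots> = c" unfolding xy by (simp add: algebra_simps)
    finally show ?thesis by (simp add: abc(2) case_prod_beta)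
  qed
  have fK: "f q \<in> K" "f r \<in> K" "f p \<in> K" using img[of 0] img[of 1] img[of t] t(3) by auto
  have "u (along (f q) (f r) s) = g 0 + s * (g 1 - g 0)"
    by (simp add: u_def along_def g_def algebra_simps)
  also have "\<dots> = u (f p)" using between t(3) by (auto simp: s_def g_def)
  finally have "f p = along (f q) (f r) s" using u_inj K_affine fK by metis
  moreover have "f q \<noteq> f r" using \<open>inj f\<close> \<open>q \<noteq> r\<close> by (simp add: inj_eq)
  ultimately show ?thesis using s strictly_between_along by blast
qed

section \<open>Forms of lines ordered by slope\<close>

text \<open>Normal vectors turning counterclockwise from \<open>(0, - 1)\<close> through
  \<open>(1, 0)\<close> towards \<open>(0, 1)\<close>, the last excluded, as the slope runs through
  the given order. They stay within half a turn, so earlier and later normals have positive cross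
  product.\<close>

definition normal :: "'a::linordered_field option \<Rightarrow> 'a \<times> 'a" where
  "normal s = (case s of None \<Rightarrow> (1, 0) | Some m \<Rightarrow> if 0 \<le> m then (m, - 1) else (- m, 1))"

lemma line_normal:
  assumes "is_line L"
  shows "\<exists>c. L = {p. Vec3 (fst (normal (slope L))) (snd (normal (slope L))) c \<bullet> homog p = 0}"
proof -
  obtain a b c where abc: "(a, b) \<noteq> (0, 0)" "L = {(x, y). a * x + b * y = c}"
    using assms unfolding is_line_def by blast
  show ?thesis
  proof (cases "b = 0")
    case True
    then have "L = {(x, y). x = c / a}" using abc by (auto simp: field_simps)
    then have "slope L = None" by (auto simp: slope_def)
    then show ?thesis
      using \<open>L = {(x, y). x = c / a}\<close> by (intro exI[of _ "- (c / a)"]) (auto simp: normal_def dot_homog)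
  next
    case False
    define m k where "m = - a / b" and "k = c / b"
    have L: "L = {(x, y). y = m * x + k}" using False abc by (auto simp: m_def k_def field_simps)
    \<comment> \<open>Two points with different first coordinates exclude a vertical equation and
      determine the slope.\<close>
    have in_L: "(0, k) \<in> L" "(1, m + k) \<in> L" using L by auto
    have "\<not> (\<exists>d. L = {(x, y). x = d})"
    proof
      assume "\<exists>d. L = {(x, y). x = d}"
      then obtain d where "L = {(x, y). x = d}" by blast
      then show False using in_L by auto
    qed
    moreover have "(THE m. \<exists>c. L = {(x, y). y = m * x + c}) = m"
    proof (rule the_equality)
      show "\<exists>c. L = {(x, y). y = m * x + c}" using L by blast
      fix m' assume "\<exists>c. L = {(x, y). y = m' * x + c}"
      then obtain k' where "L = {(x, y). y = m' * x + k'}" by blast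
      then show "m' = m" using in_L by auto
    qed
    ultimately have "slope L = Some m" by (simp add: slope_def)
    then show ?thesis
      using L by (intro exI[of _ "if 0 \<le> m then k else - k"]) (auto simp: normal_def dot_homog)
  qed
qed

lemma normal_nonzero: "normal s \<noteq> (0, 0)"
  by (auto simp: normal_def split: option.splits)

lemma normal_cross:
  "slope_less s t \<Longrightarrow> 0 < fst (normal s) * snd (normal t) - snd (normal s) * fst (normal t)"
  by (cases "(s, t)" rule: slope_less.cases) (auto simp: normal_def)

lemma det3_horizon: "det3 (Vec3 0 0 1) u v = xcoord u * ycoord v - ycoord u * xcoord v"
  unfolding det3_def by (cases u; cases v) simp

lemma det3_swap_last: "det3 u w v = - det3 u v w"
  unfolding det3_def by (cases u; cases v; cases w) (simp add: algebra_simps)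

lemma grassmann_pluecker:
  "det3 u v w * det3 u x y - det3 u v x * det3 u w y + det3 u v y * det3 u w x = 0"
  unfolding det3_def by (cases u; cases v; cases w; cases x; cases y) (simp add: algebra_simps)

text \<open>Index 0 is the line at infinity, and \<open>increasing\<close> is the slope order
  written as an orientation of triples with this line.\<close>

locale line_forms =
  fixes n :: nat and L :: "nat \<Rightarrow> ('a::linordered_field \<times> 'a) set" and l :: "nat \<Rightarrow> 'a vec3"
  assumes horizon: "l 0 = Vec3 0 0 1"
    and line: "i \<in> {1..n} \<Longrightarrow> L i = {p. l i \<bullet> homog p = 0}"
    and nondegenerate: "i \<in> {1..n} \<Longrightarrow> xcoord (l i) \<noteq> 0 \<or> ycoord (l i) \<noteq> 0"
    and increasing: "\<lbrakk>i \<in> {1..n}; j \<in> {1..n}; i < j\<rbrakk> \<Longrightarrow> 0 < det3 (l 0) (l i) (l j)"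
    and general: "\<lbrakk>i \<in> {1..n}; j \<in> {1..n}; k \<in> {1..n}; i \<noteq> j; i \<noteq> k; j \<noteq> k\<rbrakk> \<Longrightarrow> det3 (l i) (l j) (l k) \<noteq> 0"

lemma line_forms_exist:
  assumes "slope_indexed_arrangement n L"
  obtains l where "line_forms n L l"
proof -
  have lines: "is_line (L i)" if "i \<in> {1..n}" for i
    using assms that by (simp add: slope_indexed_arrangement_def line_arrangement_def)
  have slopes: "slope_less (slope (L i)) (slope (L j))" if "i \<in> {1..n}" "j \<in> {1..n}" "i < j" for i j
    using assms that by (simp add: slope_indexed_arrangement_def)
  have irrefl: "\<not> slope_less s s" for s :: "'a option" by (cases s) auto
  have distinct: "L i \<noteq> L j" if "i \<in> {1..n}" "j \<in> {1..n}" "i \<noteq> j" for i j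
    using slopes[of i j] slopes[of j i] that irrefl by (metis linorder_neqE_nat)
  have concurrent: "L i \<inter> L j \<inter> L k = {}" if "i \<in> {1..n}" "j \<in> {1..n}" "k \<in> {1..n}" "i \<noteq> j" "i \<noteq> k" "j \<noteq> k" for i j k
    using assms that distinct unfolding slope_indexed_arrangement_def line_arrangement_def by (metis imageI)
  define nx ny where "nx i = fst (normal (slope (L i)))" and "ny i = snd (normal (slope (L i)))" for i
  have "\<forall>i. \<exists>c. i \<in> {1..n} \<longrightarrow> L i = {p. Vec3 (nx i) (ny i) c \<bullet> homog p = 0}"
    unfolding nx_def ny_def using line_normal lines by blast
  then obtain c where c: "\<And>i. i \<in> {1..n} \<Longrightarrow> L i = {p. Vec3 (nx i) (ny i) (c i) \<bullet> homog p = 0}"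
    by metis
  define l where "l i = (if i = 0 then Vec3 0 0 1 else Vec3 (nx i) (ny i) (c i))" for i
  have l: "l 0 = Vec3 0 0 1" "\<And>i. i \<in> {1..n} \<Longrightarrow> l i = Vec3 (nx i) (ny i) (c i)" by (auto simp: l_def)
  have lineq: "L i = {p. l i \<bullet> homog p = 0}" if "i \<in> {1..n}" for i
    using c[OF that] l(2)[OF that] by simp
  have incr: "0 < det3 (l 0) (l i) (l j)" if "i \<in> {1..n}" "j \<in> {1..n}" "i < j" for i j
    using normal_cross[OF slopes[OF that]] l that by (simp add: det3_horizon nx_def ny_def)
  have "line_forms n L l"
  proof
    fix i assume i: "i \<in> {1..n}"
    show "xcoord (l i) \<noteq> 0 \<or> ycoord (l i) \<noteq> 0"
      using l(2)[OF i] normal_nonzero[of "slope (L i)"] by (auto simp: nx_def ny_def prod_eq_iff)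
  next
    fix i j k assume ijk: "i \<in> {1..n}" "j \<in> {1..n}" "k \<in> {1..n}" "i \<noteq> j" "i \<noteq> k" "j \<noteq> k"
    show "det3 (l i) (l j) (l k) \<noteq> 0"
    proof
      assume 0: "det3 (l i) (l j) (l k) = 0"
      define D where "D = det3 (l 0) (l i) (l j)"
      have "D \<noteq> 0"
        using incr[of i j] incr[of j i] det3_swap_last[of "l 0" "l i" "l j"] ijk
        by (cases "i < j") (auto simp: D_def)
      \<comment> \<open>Different slopes make this coordinate nonzero, so the cross product
        represents a point of the affine plane; a vanishing determinant would put that point on the
        third line.\<close>
      have "zcoord (cross (l i) (l j)) = D"
        using dot_cross[of "l 0" "l i" "l j"] det3_rotate[of "l i" "l j" "l 0"]
        by (simp add: l(1) dot_horizon D_def)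
      then have p: "homog (dehomog ((1 / D) \<odot> cross (l i) (l j))) = (1 / D) \<odot> cross (l i) (l j)"
        using \<open>D \<noteq> 0\<close> by (intro homog_dehomog) simp
      have "dehomog ((1 / D) \<odot> cross (l i) (l j)) \<in> L i \<inter> L j \<inter> L k"
        using lineq ijk 0 by (simp add: p dot_cross)
      then show False using concurrent[OF ijk] by blast
    qed
  qed (use l lineq incr in auto)
  then show ?thesis using that by blast
qed

section \<open>Intersection points and their order along a line\<close>

context line_forms
begin

abbreviation D where "D i j \<equiv> det3 (l 0) (l i) (l j)"
abbreviation \<chi> where "\<chi> i j k \<equiv> det3 (l i) (l j) (l k)"

lemma D_swap: "D j i = - D i j"
  by (rule det3_swap_last)

lemma \<chi>_swap: "\<chi> j i k = - \<chi> i j k" "\<chi> i k j = - \<chi> i j k"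
  by (rule det3_swap, rule det3_swap_last)

lemma D_nonzero: "i \<in> {1..n} \<Longrightarrow> j \<in> {1..n} \<Longrightarrow> i \<noteq> j \<Longrightarrow> D i j \<noteq> 0"
  using increasing[of i j] increasing[of j i] D_swap[of i j] by (cases "i < j") auto

definition P :: "nat \<Rightarrow> nat \<Rightarrow> 'a \<times> 'a" where
  "P i j = dehomog ((1 / D i j) \<odot> cross (l i) (l j))"

lemma homog_P:
  assumes "i \<in> {1..n}" "j \<in> {1..n}" "i \<noteq> j"
  shows "homog (P i j) = (1 / D i j) \<odot> cross (l i) (l j)"
proof -
  have "zcoord (cross (l i) (l j)) = D i j"
    using dot_cross[of "l 0" "l i" "l j"] det3_rotate[of "l i" "l j" "l 0"] by (simp add: horizon dot_horizon)
  then show ?thesis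
    unfolding P_def using D_nonzero[OF assms] by (intro homog_dehomog) simp
qed

lemma dot_P:
  assumes "i \<in> {1..n}" "j \<in> {1..n}" "i \<noteq> j"
  shows "l k \<bullet> homog (P i j) = \<chi> i j k / D i j"
  unfolding homog_P[OF assms] by (simp add: dot_cross)

lemma homog_eqI:
  assumes "i \<in> {1..n}" "j \<in> {1..n}" "i \<noteq> j" "l i \<bullet> homog p = l i \<bullet> homog q" "l j \<bullet> homog p = l j \<bullet> homog q"
  shows "p = q"
proof (rule homog_inject, rule det3_eqI)
  show "D i j \<noteq> 0" by (rule D_nonzero[OF assms(1-3)])
  show "l 0 \<bullet> homog p = l 0 \<bullet> homog q" by (simp add: horizon dot_homog)
qed (use assms in auto)

lemma inter_lines:
  assumes "i \<in> {1..n}" "j \<in> {1..n}" "i \<noteq> j"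
  shows "L i \<inter> L j = {P i j}"
proof -
  have "P i j \<in> L i \<inter> L j" using line assms(1,2) by (simp add: dot_P[OF assms])
  moreover have "p = P i j" if "p \<in> L i \<inter> L j" for p
    using that line assms(1,2) by (intro homog_eqI[OF assms]) (simp_all add: dot_P[OF assms])
  ultimately show ?thesis by blast
qed

lemma line_distinct: "i \<in> {1..n} \<Longrightarrow> j \<in> {1..n} \<Longrightarrow> L i = L j \<Longrightarrow> i = j"
proof (rule ccontr)
  assume ij: "i \<in> {1..n}" "j \<in> {1..n}" "L i = L j" "i \<noteq> j"
  define p where "p = P i j"
  have "l i \<bullet> homog p = 0" "l j \<bullet> homog p = 0" using inter_lines[OF ij(1,2,4)] line ij by (auto simp: p_def)
  \<comment> \<open>A second point of line \<open>i\<close>, reached from the intersection point in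
    the direction of the line.\<close>
  define q where "q = (fst p + ycoord (l i), snd p - xcoord (l i))"
  have "l i \<bullet> homog q = 0" using \<open>l i \<bullet> homog p = 0\<close> by (simp add: q_def dot_homog algebra_simps)
  then have "q \<in> L i \<inter> L j" using line ij by auto
  then have "q = p" using inter_lines[OF ij(1,2,4)] by (simp add: p_def)
  then show False using nondegenerate[OF ij(1)] by (auto simp: q_def prod_eq_iff)
qed

lemma P_swap: "i \<in> {1..n} \<Longrightarrow> j \<in> {1..n} \<Longrightarrow> i \<noteq> j \<Longrightarrow> P j i = P i j"
  using inter_lines[of i j] inter_lines[of j i] by (simp add: Int_commute)

lemma P_inject:
  assumes "i \<in> {1..n}" "j \<in> {1..n}" "i \<noteq> j" "i' \<in> {1..n}" "j' \<in> {1..n}" "i' \<noteq> j'" "P i j = P i' j'"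
  shows "i' = i \<and> j' = j \<or> i' = j \<and> j' = i"
proof -
  have z: "k = i \<or> k = j" if k: "k \<in> {1..n}" "l k \<bullet> homog (P i j) = 0" for k
  proof -
    have "\<chi> i j k = 0" using k(2) D_nonzero[OF assms(1-3)] by (simp add: dot_P[OF assms(1-3)])
    then show ?thesis using general[OF assms(1,2) k(1) assms(3)] by blast
  qed
  have "l i' \<bullet> homog (P i j) = 0" "l j' \<bullet> homog (P i j) = 0"
    unfolding assms(7) dot_P[OF assms(4-6)] by simp_all
  then show ?thesis using z assms by metis
qed

lemma intersection_points_on:
  assumes "S \<subseteq> {1..n}" "a \<in> S"
  shows "intersection_points (L ` S) \<inter> L a = P a ` (S - {a})"
proof (intro equalityI subsetI)
  fix p assume "p \<in> intersection_points (L ` S) \<inter> L a"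
  then obtain i j where ij: "i \<in> S" "j \<in> S" "L i \<noteq> L j" "p \<in> L i" "p \<in> L j" "p \<in> L a"
    unfolding intersection_points_def by blast
  then have *: "i \<in> {1..n}" "j \<in> {1..n}" "a \<in> {1..n}" using assms by auto
  show "p \<in> P a ` (S - {a})"
  proof (cases "i = a")
    case True
    then have "p \<in> L a \<inter> L j" "j \<noteq> a" using ij by auto
    then have "p = P a j" using inter_lines[of a j] * by auto
    then show ?thesis using ij \<open>j \<noteq> a\<close> by blast
  next
    case False
    then have "p = P a i" using inter_lines[of a i] * ij by auto
    then show ?thesis using ij False by blast
  qed
next
  fix p assume "p \<in> P a ` (S - {a})"
  then obtain b where b: "b \<in> S" "b \<noteq> a" "p = P a b" by blast
  then have *: "b \<in> {1..n}" "a \<in> {1..n}" using assms by auto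
  then have "p \<in> L a \<inter> L b" using inter_lines[of a b] b by auto
  moreover have "L a \<noteq> L b" using line_distinct * b by blast
  ultimately show "p \<in> intersection_points (L ` S) \<inter> L a"
    using assms b unfolding intersection_points_def by blast
qed

text \<open>The values of \<open>l b\<close> at \<open>P a c\<close> and \<open>P a d\<close> are
  \<open>- \<chi> a b c / D a c\<close> and \<open>- \<chi> a b d / D a d\<close>; the condition
  says that line \<open>b\<close> separates these two points.\<close>

lemma strictly_between_P:
  assumes abcd: "a \<in> {1..n}" "b \<in> {1..n}" "c \<in> {1..n}" "d \<in> {1..n}" "distinct [a, b, c, d]"
  shows "strictly_between (P a c) (P a b) (P a d) \<longleftrightarrow> \<chi> a b c * \<chi> a b d * (D a c * D a d) < 0"
proof -
  have ne: "a \<noteq> b" "a \<noteq> c" "a \<noteq> d" "b \<noteq> c" "b \<noteq> d" "c \<noteq> d" using abcd(5) by auto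
  define w x y where "w = \<chi> a b c" and "x = \<chi> a b d" and "y = \<chi> a c d"
  define B C E where "B = D a b" and "C = D a c" and "E = D a d"
  have nz: "w \<noteq> 0" "x \<noteq> 0" "y \<noteq> 0" "B \<noteq> 0" "C \<noteq> 0" "E \<noteq> 0"
    unfolding w_def x_def y_def B_def C_def E_def by (rule general D_nonzero; fact)+
  have gp: "C * x = B * y + E * w"
    using grassmann_pluecker[of "l a" "l 0" "l b" "l c" "l d"] det3_swap[of "l a" "l 0"]
    by (simp add: w_def x_def y_def B_def C_def E_def algebra_simps)
  have vals: "l c \<bullet> homog (P a c) = 0" "l c \<bullet> homog (P a b) = w / B" "l c \<bullet> homog (P a d) = - (y / E)"
    "l d \<bullet> homog (P a c) = y / C" "l d \<bullet> homog (P a b) = x / B" "l d \<bullet> homog (P a d) = 0"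
    "l a \<bullet> homog (P a b) = 0" "l a \<bullet> homog (P a c) = 0" "l a \<bullet> homog (P a d) = 0"
    using \<chi>_swap(2)[where i = a and j = c and k = d]
    by (simp_all add: dot_P[OF abcd(1,2) ne(1)] dot_P[OF abcd(1,3) ne(2)] dot_P[OF abcd(1,4) ne(3)]
        w_def x_def y_def B_def C_def E_def)
  have "P a c \<noteq> P a d" using vals(1,3) nz by auto
  have on_line: "P a b = along (P a c) (P a d) t \<longleftrightarrow> w / B = - (t * (y / E))" for t
  proof
    assume "P a b = along (P a c) (P a d) t"
    from arg_cong[OF this, of "\<lambda>p. l c \<bullet> homog p"] show "w / B = - (t * (y / E))"
      by (simp add: dot_along vals)
  next
    assume "w / B = - (t * (y / E))"
    then show "P a b = along (P a c) (P a d) t"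
      using abcd ne by (intro homog_eqI[of a c]) (simp_all add: dot_along vals)
  qed
  define t where "t = - (w * E) / (B * y)"
  have t: "w / B = - (s * (y / E)) \<longleftrightarrow> s = t" for s
    using nz by (auto simp: t_def field_simps)
  \<comment> \<open>The Grassmann--Pluecker relation factors \<open>1 - t\<close> like
    \<open>t\<close>, so the sign of \<open>t * (1 - t)\<close> can be read off a product of
    orientations.\<close>
  have "1 - t = x * C / (B * y)"
    using nz gp by (simp add: t_def field_simps)
  then have "t * (1 - t) = - (w * x * (C * E)) / (B * y)\<^sup>2"
    by (simp add: t_def power2_eq_square)
  then have "0 < t * (1 - t) \<longleftrightarrow> w * x * (C * E) < 0"
    using nz by (simp add: divide_less_0_iff not_less)
  moreover have "0 < t * (1 - t) \<longleftrightarrow> 0 < t \<and> t < 1" by (auto simp: zero_less_mult_iff)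
  ultimately show ?thesis
    unfolding strictly_between_along on_line t using \<open>P a c \<noteq> P a d\<close> by (auto simp: w_def x_def C_def E_def)
qed

lemma middle_point_P:
  assumes abcd: "a \<in> {1..n}" "b \<in> {1..n}" "c \<in> {1..n}" "d \<in> {1..n}" "distinct [a, b, c, d]"
    and S: "S = {a, b, c, d}"
  shows "middle_point_on (L ` S) (L a) (P a b) \<longleftrightarrow> \<chi> a b c * \<chi> a b d * (D a c * D a d) < 0"
proof -
  have "S - {a} = {b, c, d}" using abcd S by auto
  then have pts: "intersection_points (L ` S) \<inter> L a = {P a b, P a c, P a d}"
    using intersection_points_on[of S a] abcd S by auto
  have ne: "P a b \<noteq> P a c" "P a b \<noteq> P a d" "P a c \<noteq> P a d"
    using P_inject[of a b a c] P_inject[of a b a d] P_inject[of a c a d] abcd by auto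
  have "middle_point_on (L ` S) (L a) (P a b) \<longleftrightarrow> strictly_between (P a c) (P a b) (P a d)"
    unfolding middle_point_on_def pts
  proof
    assume "\<exists>q r. {P a b, P a c, P a d} = {q, P a b, r} \<and> strictly_between q (P a b) r"
    then obtain q r where qr: "{P a b, P a c, P a d} = {q, P a b, r}" "strictly_between q (P a b) r" by blast
    then have "q = P a c \<and> r = P a d \<or> q = P a d \<and> r = P a c"
      using strictly_between_neq[OF qr(2)] ne by (metis insert_iff singletonD)
    then show "strictly_between (P a c) (P a b) (P a d)" using qr(2) strictly_between_sym by blast
  next
    assume "strictly_between (P a c) (P a b) (P a d)"
    then show "\<exists>q r. {P a b, P a c, P a d} = {q, P a b, r} \<and> strictly_between q (P a b) r"
      by (intro exI[of _ "P a c"] exI[of _ "P a d"]) auto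
  qed
  then show ?thesis using strictly_between_P[OF abcd] by simp
qed

end

section \<open>Nook points of four lines\<close>

definition is_nook :: "'a::linordered_field plane_set set \<Rightarrow> 'a \<times> 'a \<Rightarrow> bool" where
  "is_nook A p \<longleftrightarrow> (\<exists>L\<in>A. \<exists>K\<in>A. L \<noteq> K \<and> p \<in> L \<inter> K \<and> middle_point_on A L p \<and> middle_point_on A K p)"

lemma nook_point_is_nook: "nook_point A = (THE p. is_nook A p)"
  by (simp add: nook_point_def is_nook_def)

lemma sorted_four:
  fixes S :: "nat set"
  assumes "card S = 4"
  obtains a b c d where "a < b" "b < c" "c < d" "S = {a, b, c, d}"
proof -
  have "finite S" using assms card.infinite by fastforce
  define xs where "xs = sorted_list_of_set S"
  have "length xs = 4" "set xs = S" "sorted xs" "distinct xs"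
    using \<open>finite S\<close> assms by (simp_all add: xs_def)
  moreover from this obtain a b c d where "xs = [a, b, c, d]"
    by (auto simp: length_Suc_conv numeral_eq_Suc)
  ultimately show ?thesis using that[of a b c d] by (auto simp: order_less_le)
qed

lemma opposite_signs:
  fixes u v :: "'a::linordered_field"
  assumes "u \<noteq> 0" "v \<noteq> 0"
  shows "u * v < 0 \<longleftrightarrow> (0 < u) \<noteq> (0 < v)"
  using assms by (auto simp: mult_less_0_iff)

lemma positive_combination:
  fixes u v w :: "'a::linordered_field"
  assumes "e * u = f * v + g * w" "0 < e" "0 < f" "0 < g" "u \<noteq> 0" "v \<noteq> 0" "w \<noteq> 0" "(0 < v) = (0 < w)"
  shows "(0 < u) = (0 < v)"
proof (cases "0 < v")
  case True
  then have "0 < e * u" using assms by (simp add: add_pos_pos)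
  then show ?thesis using True assms(2) by (simp add: zero_less_mult_iff)
next
  case False
  then have "f * v < 0" "g * w < 0" using assms by (auto simp: mult_less_0_iff)
  then have "e * u < 0" using assms(1) by simp
  then show ?thesis using False assms(2) by (simp add: mult_less_0_iff)
qed

context line_forms
begin

text \<open>The same point is written \<open>P i j\<close> on line \<open>i\<close> and
  \<open>P j i\<close> on line \<open>j\<close>, which makes the condition visibly symmetric and
  fits the criterion for middle points.\<close>

abbreviation nook_pair where
  "nook_pair S i j \<equiv> middle_point_on (L ` S) (L i) (P i j) \<and> middle_point_on (L ` S) (L j) (P j i)"

abbreviation pos where "pos i j k \<equiv> 0 < \<chi> i j k"

lemma is_nook_iff:
  assumes "S \<subseteq> {1..n}"
  shows "is_nook (L ` S) p \<longleftrightarrow> (\<exists>i\<in>S. \<exists>j\<in>S. i \<noteq> j \<and> p = P i j \<and> nook_pair S i j)"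
proof
  assume "is_nook (L ` S) p"
  then obtain i j where ij: "i \<in> S" "j \<in> S" "L i \<noteq> L j" "p \<in> L i \<inter> L j" "middle_point_on (L ` S) (L i) p" "middle_point_on (L ` S) (L j) p"
    unfolding is_nook_def by blast
  then have *: "i \<in> {1..n}" "j \<in> {1..n}" "i \<noteq> j" using assms by auto
  then have "p = P i j" "p = P j i" using inter_lines[OF *] P_swap[OF *] ij(4) by auto
  then show "\<exists>i\<in>S. \<exists>j\<in>S. i \<noteq> j \<and> p = P i j \<and> nook_pair S i j" using ij * by metis
next
  assume "\<exists>i\<in>S. \<exists>j\<in>S. i \<noteq> j \<and> p = P i j \<and> nook_pair S i j"
  then obtain i j where ij: "i \<in> S" "j \<in> S" "i \<noteq> j" "p = P i j" "nook_pair S i j" by blast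
  then have *: "i \<in> {1..n}" "j \<in> {1..n}" using assms by auto
  have "L i \<noteq> L j" using line_distinct * ij(3) by blast
  moreover have "p \<in> L i \<inter> L j" using inter_lines[OF * ij(3)] ij(4) by simp
  ultimately show "is_nook (L ` S) p"
    unfolding is_nook_def using ij P_swap[OF * ij(3)] by (metis imageI)
qed

lemma chi_perms:
  "\<chi> i k j = - \<chi> i j k" "\<chi> j i k = - \<chi> i j k" "\<chi> j k i = \<chi> i j k" "\<chi> k i j = \<chi> i j k" "\<chi> k j i = - \<chi> i j k"
  using det3_swap_last[of "l i" "l k" "l j"] det3_swap[of "l j" "l i" "l k"] det3_rotate[of "l j" "l k" "l i"]
    det3_rotate[of "l i" "l j" "l k"] det3_swap_last[of "l k" "l j" "l i"]
  by simp_all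

text \<open>All \<open>D\<close> of increasing pairs are positive, so being a middle point depends
  only on the four orientations. For the pairs \<open>a\<close>, \<open>c\<close> and
  \<open>b\<close>, \<open>d\<close> the two lines impose opposite sign conditions.\<close>

lemma nook_pairs_four:
  assumes abcd: "a \<in> {1..n}" "b \<in> {1..n}" "c \<in> {1..n}" "d \<in> {1..n}" "a < b" "b < c" "c < d"
    and S: "S = {a, b, c, d}"
  shows "nook_pair S a b \<longleftrightarrow> pos a b c \<noteq> pos a b d"
    and "nook_pair S b c \<longleftrightarrow> pos a b c = pos b c d"
    and "nook_pair S c d \<longleftrightarrow> pos a c d \<noteq> pos b c d"
    and "nook_pair S a d \<longleftrightarrow> pos a b d \<noteq> pos a c d"
    and "\<not> nook_pair S a c" and "\<not> nook_pair S b d"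
proof -
  have ne: "a \<noteq> b" "a \<noteq> c" "a \<noteq> d" "b \<noteq> c" "b \<noteq> d" "c \<noteq> d" using abcd by auto
  define w x y z where "w = \<chi> a b c" and "x = \<chi> a b d" and "y = \<chi> a c d" and "z = \<chi> b c d"
  have nz: "w \<noteq> 0" "x \<noteq> 0" "y \<noteq> 0" "z \<noteq> 0"
    unfolding w_def x_def y_def z_def by (rule general; fact)+
  have D: "0 < D a b" "0 < D a c" "0 < D a d" "0 < D b c" "0 < D b d" "0 < D c d"
    by (rule increasing; use abcd in auto)+
  have Dn: "D b a = - D a b" "D c a = - D a c" "D d a = - D a d" "D c b = - D b c" "D d b = - D b d" "D d c = - D c d"
    using D_swap by blast+
  note perms = w_def[symmetric] x_def[symmetric] y_def[symmetric] z_def[symmetric]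
    chi_perms[where i = a and j = b and k = c, folded w_def] chi_perms[where i = a and j = b and k = d, folded x_def]
    chi_perms[where i = a and j = c and k = d, folded y_def] chi_perms[where i = b and j = c and k = d, folded z_def]
  have mid: "middle_point_on (L ` S) (L i) (P i j) \<longleftrightarrow> \<chi> i j k * \<chi> i j m * (D i k * D i m) < 0"
    if "{i, j, k, m} = S" "distinct [i, j, k, m]" for i j k m
  proof -
    have "i \<in> S" "j \<in> S" "k \<in> S" "m \<in> S" using that(1) by blast+
    moreover have "S \<subseteq> {1..n}" using S abcd by auto
    ultimately show ?thesis using middle_point_P[OF _ _ _ _ that(2) that(1)[symmetric]] by blast
  qed
  note signs = mult_less_0_iff zero_less_mult_iff
  have ab1: "middle_point_on (L ` S) (L a) (P a b) \<longleftrightarrow> w * x < 0"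
    using D nz by (subst mid[of a b c d]) (use S ne in \<open>auto simp: perms Dn signs\<close>)
  have ab2: "middle_point_on (L ` S) (L b) (P b a) \<longleftrightarrow> w * x < 0"
    using D nz by (subst mid[of b a c d]) (use S ne in \<open>auto simp: perms Dn signs\<close>)
  have bc1: "middle_point_on (L ` S) (L b) (P b c) \<longleftrightarrow> 0 < w * z"
    using D nz by (subst mid[of b c a d]) (use S ne in \<open>auto simp: perms Dn signs\<close>)
  have bc2: "middle_point_on (L ` S) (L c) (P c b) \<longleftrightarrow> 0 < w * z"
    using D nz by (subst mid[of c b a d]) (use S ne in \<open>auto simp: perms Dn signs\<close>)
  have cd1: "middle_point_on (L ` S) (L c) (P c d) \<longleftrightarrow> y * z < 0"
    using D nz by (subst mid[of c d a b]) (use S ne in \<open>auto simp: perms Dn signs\<close>)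
  have cd2: "middle_point_on (L ` S) (L d) (P d c) \<longleftrightarrow> y * z < 0"
    using D nz by (subst mid[of d c a b]) (use S ne in \<open>auto simp: perms Dn signs\<close>)
  have ad1: "middle_point_on (L ` S) (L a) (P a d) \<longleftrightarrow> x * y < 0"
    using D nz by (subst mid[of a d b c]) (use S ne in \<open>auto simp: perms Dn signs\<close>)
  have ad2: "middle_point_on (L ` S) (L d) (P d a) \<longleftrightarrow> x * y < 0"
    using D nz by (subst mid[of d a b c]) (use S ne in \<open>auto simp: perms Dn signs\<close>)
  have ac1: "middle_point_on (L ` S) (L a) (P a c) \<longleftrightarrow> 0 < w * y"
    using D nz by (subst mid[of a c b d]) (use S ne in \<open>auto simp: perms Dn signs\<close>)
  have ac2: "middle_point_on (L ` S) (L c) (P c a) \<longleftrightarrow> w * y < 0"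
    using D nz by (subst mid[of c a b d]) (use S ne in \<open>auto simp: perms Dn signs\<close>)
  have bd1: "middle_point_on (L ` S) (L b) (P b d) \<longleftrightarrow> x * z < 0"
    using D nz by (subst mid[of b d a c]) (use S ne in \<open>auto simp: perms Dn signs\<close>)
  have bd2: "middle_point_on (L ` S) (L d) (P d b) \<longleftrightarrow> 0 < x * z"
    using D nz by (subst mid[of d b a c]) (use S ne in \<open>auto simp: perms Dn signs\<close>)
  note os = opposite_signs[OF nz(1,2)] opposite_signs[OF nz(3,4)] opposite_signs[OF nz(2,3)]
  show "nook_pair S a b \<longleftrightarrow> pos a b c \<noteq> pos a b d" "nook_pair S c d \<longleftrightarrow> pos a c d \<noteq> pos b c d"
    "nook_pair S a d \<longleftrightarrow> pos a b d \<noteq> pos a c d"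
    unfolding ab1 ab2 cd1 cd2 ad1 ad2 os by (simp_all add: w_def x_def y_def z_def)
  have "0 < w * z \<longleftrightarrow> (0 < w) = (0 < z)" using nz by (auto simp: zero_less_mult_iff)
  then show "nook_pair S b c \<longleftrightarrow> pos a b c = pos b c d" unfolding bc1 bc2 by (simp add: w_def z_def)
  show "\<not> nook_pair S a c" "\<not> nook_pair S b d" unfolding ac1 ac2 bd1 bd2 by simp_all
qed

text \<open>By the Grassmann--Pluecker relations the orientations of the four triples, in lexicographic
  order, change sign at most once, and the position of the change determines the nook.\<close>

lemma orientations_four:
  assumes abcd: "a \<in> {1..n}" "b \<in> {1..n}" "c \<in> {1..n}" "d \<in> {1..n}" "a < b" "b < c" "c < d"
  shows "pos a b c = pos a c d \<Longrightarrow> pos a b d = pos a b c"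
    and "pos a b c = pos b c d \<Longrightarrow> pos a b d = pos a b c"
    and "pos a b c = pos b c d \<Longrightarrow> pos a c d = pos a b c"
    and "pos a b d = pos b c d \<Longrightarrow> pos a c d = pos a b d"
proof -
  have ne: "a \<noteq> b" "a \<noteq> c" "a \<noteq> d" "b \<noteq> c" "b \<noteq> d" "c \<noteq> d" using abcd by auto
  define w x y z where "w = \<chi> a b c" and "x = \<chi> a b d" and "y = \<chi> a c d" and "z = \<chi> b c d"
  have nz: "w \<noteq> 0" "x \<noteq> 0" "y \<noteq> 0" "z \<noteq> 0"
    unfolding w_def x_def y_def z_def by (rule general; fact)+
  have D: "0 < D a b" "0 < D a c" "0 < D a d" "0 < D b c" "0 < D b d" "0 < D c d"
    by (rule increasing; use abcd in auto)+
  \<comment> \<open>One three-term relation for each of the lines \<open>a\<close>,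
    \<open>b\<close>, \<open>c\<close>, \<open>d\<close> as common vector; the coefficients are
    positive, so equal signs on the right force the sign on the left.\<close>
  have "D a c * x = D a b * y + D a d * w" "D b c * x = D a b * z + D b d * w"
    "D b c * y = D a c * z + D c d * w" "D b d * y = D a d * z + D c d * x"
    unfolding w_def x_def y_def z_def det3_def
    by (cases "l 0"; cases "l a"; cases "l b"; cases "l c"; cases "l d"; simp add: algebra_simps)+
  note gp = this
  show "pos a b c = pos a c d \<Longrightarrow> pos a b d = pos a b c"
    using positive_combination[OF gp(1) D(2,1,3) nz(2,3,1)] by (auto simp: w_def x_def y_def)
  show "pos a b c = pos b c d \<Longrightarrow> pos a b d = pos a b c"
    using positive_combination[OF gp(2) D(4,1,5) nz(2,4,1)] by (auto simp: w_def x_def z_def)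
  show "pos a b c = pos b c d \<Longrightarrow> pos a c d = pos a b c"
    using positive_combination[OF gp(3) D(4,2,6) nz(3,4,1)] by (auto simp: w_def y_def z_def)
  show "pos a b d = pos b c d \<Longrightarrow> pos a c d = pos a b d"
    using positive_combination[OF gp(4) D(5,3,6) nz(3,4,2)] by (auto simp: x_def y_def z_def)
qed

text \<open>In the sign sequence of \<open>abc\<close>, \<open>abd\<close>, \<open>acd\<close>,
  \<open>bcd\<close>, a change after the first, second or third term gives the nook of
  \<open>a\<close>, \<open>b\<close>, of \<open>a\<close>, \<open>d\<close> or of \<open>c\<close>,
  \<open>d\<close>; without a change it is that of \<open>b\<close>, \<open>c\<close>.\<close>

lemma unique_nook_pair:
  assumes "S \<subseteq> {1..n}" "card S = 4"
  obtains i j where "i \<in> S" "j \<in> S" "i \<noteq> j" "nook_pair S i j"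
    "\<And>i' j'. \<lbrakk>i' \<in> S; j' \<in> S; i' \<noteq> j'; nook_pair S i' j'\<rbrakk> \<Longrightarrow> i' = i \<and> j' = j \<or> i' = j \<and> j' = i"
proof -
  obtain a b c d where lt: "a < b" "b < c" "c < d" and S: "S = {a, b, c, d}"
    using sorted_four[OF assms(2)] by blast
  then have mem: "a \<in> {1..n}" "b \<in> {1..n}" "c \<in> {1..n}" "d \<in> {1..n}" using assms(1) by auto
  note pairs = nook_pairs_four[OF mem lt S] and orient = orientations_four[OF mem lt]
  define N where "N i j \<longleftrightarrow> nook_pair S i j" for i j
  have sym: "N j i = N i j" for i j unfolding N_def by blast
  note pairs' = pairs[folded N_def]
  have "\<exists>i j. i \<in> S \<and> j \<in> S \<and> i \<noteq> j \<and> N i j \<and>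
    (\<forall>i' j'. i' \<in> S \<and> j' \<in> S \<and> i' \<noteq> j' \<and> N i' j' \<longrightarrow> i' = i \<and> j' = j \<or> i' = j \<and> j' = i)"
  proof -
    consider "N a b" "\<not> N b c" "\<not> N c d" "\<not> N a d" | "\<not> N a b" "N b c" "\<not> N c d" "\<not> N a d"
      | "\<not> N a b" "\<not> N b c" "N c d" "\<not> N a d" | "\<not> N a b" "\<not> N b c" "\<not> N c d" "N a d"
      using pairs' orient by argo
    then show ?thesis
    proof cases
      case 1
      show ?thesis
        by (rule exI[of _ a], rule exI[of _ b]) (use 1 lt S pairs'(5,6) sym in auto)
    next
      case 2
      show ?thesis
        by (rule exI[of _ b], rule exI[of _ c]) (use 2 lt S pairs'(5,6) sym in auto)
    next
      case 3
      show ?thesis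
        by (rule exI[of _ c], rule exI[of _ d]) (use 3 lt S pairs'(5,6) sym in auto)
    next
      case 4
      show ?thesis
        by (rule exI[of _ a], rule exI[of _ d]) (use 4 lt S pairs'(5,6) sym in auto)
    qed
  qed
  then show ?thesis using that unfolding N_def by blast
qed

text \<open>Uniqueness makes the description in \<open>nook_point\<close> proper, and distinct pairs
  of lines meet in distinct points, so a pair of lines is identified by its point.\<close>

lemma nook_point_four:
  assumes "S \<subseteq> {1..n}" "card S = 4"
  shows ex1_nook: "\<exists>!p. is_nook (L ` S) p"
    and nook_point_iff: "\<lbrakk>i \<in> S; j \<in> S; i \<noteq> j\<rbrakk> \<Longrightarrow> L i \<inter> L j = {nook_point (L ` S)} \<longleftrightarrow> nook_pair S i j"
    and nook_point_exists: "\<exists>i\<in>S. \<exists>j\<in>S. i \<noteq> j \<and> L i \<inter> L j = {nook_point (L ` S)}"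
proof -
  obtain a b where ab: "a \<in> S" "b \<in> S" "a \<noteq> b" "nook_pair S a b"
    and uniq: "\<And>i' j'. \<lbrakk>i' \<in> S; j' \<in> S; i' \<noteq> j'; nook_pair S i' j'\<rbrakk> \<Longrightarrow> i' = a \<and> j' = b \<or> i' = b \<and> j' = a"
    by (rule unique_nook_pair[OF assms]) (rule that)
  have mem: "a \<in> {1..n}" "b \<in> {1..n}" using ab assms by auto
  have "is_nook (L ` S) (P a b)" using is_nook_iff[OF assms(1)] ab by blast
  moreover have "p = P a b" if nook: "is_nook (L ` S) p" for p
  proof -
    obtain i j where "i \<in> S" "j \<in> S" "i \<noteq> j" "p = P i j" "nook_pair S i j"
      using nook is_nook_iff[OF assms(1)] by blast
    then show ?thesis using uniq P_swap[OF mem ab(3)] by metis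
  qed
  ultimately have ex1: "\<exists>!p. is_nook (L ` S) p" and nook: "nook_point (L ` S) = P a b"
    unfolding nook_point_is_nook by (blast, intro the_equality)
  show "\<exists>!p. is_nook (L ` S) p" by (rule ex1)
  have "L a \<inter> L b = {nook_point (L ` S)}" unfolding nook by (rule inter_lines[OF mem ab(3)])
  then show "\<exists>i\<in>S. \<exists>j\<in>S. i \<noteq> j \<and> L i \<inter> L j = {nook_point (L ` S)}" using ab by blast
  show "L i \<inter> L j = {nook_point (L ` S)} \<longleftrightarrow> nook_pair S i j" if ij: "i \<in> S" "j \<in> S" "i \<noteq> j"
  proof
    have mem': "i \<in> {1..n}" "j \<in> {1..n}" using ij assms by auto
    assume "L i \<inter> L j = {nook_point (L ` S)}"
    then have "P a b = P i j" unfolding nook inter_lines[OF mem' ij(3)] by simp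
    then show "nook_pair S i j" using P_inject[OF mem ab(3) mem' ij(3)] ab(4) by blast
  next
    assume "nook_pair S i j"
    then have "i = a \<and> j = b \<or> i = b \<and> j = a" by (rule uniq[OF ij])
    then show "L i \<inter> L j = {nook_point (L ` S)}"
      using inter_lines[OF mem ab(3)] nook by (auto simp: Int_commute)
  qed
qed

end

section \<open>Arrangements with the same nook points\<close>

text \<open>Transpositions of neighbouring positions generate all permutations of three
  places.\<close>

lemma distinct_triples_sorted:
  fixes i j k :: "'i::linorder"
  assumes swap: "\<And>i j k. Q i j k \<Longrightarrow> Q j i k" "\<And>i j k. Q i j k \<Longrightarrow> Q i k j"
    and sorted: "\<And>i j k. \<lbrakk>i \<in> I; j \<in> I; k \<in> I; i < j; j < k\<rbrakk> \<Longrightarrow> Q i j k"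
    and "i \<in> I" "j \<in> I" "k \<in> I" "i \<noteq> j" "i \<noteq> k" "j \<noteq> k"
  shows "Q i j k"
proof -
  consider "i < j" "j < k" | "i < k" "k < j" | "j < i" "i < k" | "j < k" "k < i" | "k < i" "i < j" | "k < j" "j < i"
    using assms(7-9) by (metis linorder_less_linear)
  then show ?thesis
  proof cases
    case 1 then show ?thesis using sorted assms(4-6) by blast
  next
    case 2 then show ?thesis using swap(2)[OF sorted[of i k j]] assms(4-6) by blast
  next
    case 3 then show ?thesis using swap(1)[OF sorted[of j i k]] assms(4-6) by blast
  next
    case 4 then show ?thesis using swap(1)[OF swap(2)[OF sorted[of j k i]]] assms(4-6) by blast
  next
    case 5 then show ?thesis using swap(2)[OF swap(1)[OF sorted[of k i j]]] assms(4-6) by blast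
  next
    case 6 then show ?thesis using swap(2)[OF swap(1)[OF swap(2)[OF sorted[of k j i]]]] assms(4-6) by blast
  qed
qed

lemma pl_automorphism_id: "pl_automorphism (\<lambda>p. p)"
proof -
  have "convex_polygonal_piece UNIV"
    unfolding convex_polygonal_piece_def plane_interior_def
    by (intro conjI exI[of _ "{}"]) (auto intro: exI[of _ 1])
  then have "polygonal_decomposition {UNIV}" by (simp add: polygonal_decomposition_def)
  moreover have "affine_map (\<lambda>p. p)"
    unfolding affine_map_def by (rule exI[of _ 1], rule exI[of _ 0], rule exI[of _ 0], rule exI[of _ 1]) (auto intro: exI[of _ 0])
  ultimately show ?thesis unfolding pl_automorphism_def by (auto simp: bij_def)
qed

section \<open>Realising orientations by piecewise linear automorphisms\<close>

context line_forms
begin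

lemma vector_configuration:
  assumes "2 \<le> n"
  shows "vector_configuration {0..n} l"
proof
  fix i j k assume "i \<in> {0..n}" "j \<in> {0..n}" "k \<in> {0..n}" "i \<noteq> j" "i \<noteq> k" "j \<noteq> k"
  then show "\<chi> i j k \<noteq> 0"
  proof (rule distinct_triples_sorted[where Q = "\<lambda>i j k. \<chi> i j k \<noteq> 0", rotated -6])
    show "\<chi> j i k \<noteq> 0" "\<chi> i k j \<noteq> 0" if "\<chi> i j k \<noteq> 0" for i j k
      using that chi_perms(1,2)[of i j k] by simp_all
    show "\<chi> i j k \<noteq> 0" if "i \<in> {0..n}" "j \<in> {0..n}" "k \<in> {0..n}" "i < j" "j < k" for i j k
      using that D_nonzero[of j k] general[of i j k] by (cases "i = 0") auto
  qed
qed (use assms in auto)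

text \<open>The orientation normalisation fixes the forms of the lines only up to a common sign.\<close>

lemma negated_forms: "line_forms n L (\<lambda>i. if i = 0 then l 0 else - l i)"
proof -
  have neg: "det3 (- u) v w = - det3 u v w" "det3 u (- v) w = - det3 u v w" "det3 u v (- w) = - det3 u v w" for u v w :: "'a vec3"
    unfolding det3_def by (cases u; cases v; cases w; simp add: algebra_simps)+
  have dot_neg: "(- u) \<bullet> p = - (u \<bullet> p)" for u p :: "'a vec3"
    by (cases u; cases p) simp
  have coord: "xcoord (- u) = - xcoord u" "ycoord (- u) = - ycoord u" for u :: "'a vec3"
    by (cases u; simp)+
  show ?thesis
    by unfold_locales (use horizon line nondegenerate increasing general in \<open>auto simp: neg dot_neg coord\<close>)
qed

text \<open>One line and the line at infinity provide only two forms. The perpendicular through the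
  origin is added; its determinant with the other two is a sum of squares.\<close>

lemma extend_single_line:
  assumes "n = 1"
  obtains L' l' where "line_forms 2 L' l'" "L' 1 = L 1"
proof -
  define v where "v = Vec3 (- ycoord (l 1)) (xcoord (l 1)) 0"
  define L' where "L' = L(2 := {p. v \<bullet> homog p = 0})"
  define l' where "l' = l(2 := v)"
  have nz: "xcoord (l 1) \<noteq> 0 \<or> ycoord (l 1) \<noteq> 0" using nondegenerate[of 1] assms by simp
  have pos: "0 < det3 (l 0) (l 1) v"
    using nz by (simp add: horizon det3_horizon v_def sum_squares_gt_zero_iff)
  have two: "i \<in> {Suc 0..2} \<longleftrightarrow> i = Suc 0 \<or> i = 2" for i :: nat by auto
  have "line_forms 2 L' l'"
    by unfold_locales
      (use line[of 1] assms nz pos horizon in \<open>auto simp: two L'_def l'_def v_def simp del: atLeastAtMost_iff\<close>)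
  then show ?thesis using that by (simp add: L'_def)
qed

end

lemma pl_automorphism_of_agreeing_orientations:
  assumes "line_forms n L l" "line_forms n L' l'" "2 \<le> n"
    and agree: "\<And>i j k. \<lbrakk>i \<in> {1..n}; j \<in> {1..n}; k \<in> {1..n}; i < j; j < k\<rbrakk> \<Longrightarrow>
      (0 < det3 (l i) (l j) (l k)) = (0 < det3 (l' i) (l' j) (l' k))"
  obtains f where "pl_automorphism f" "\<And>i. i \<in> {1..n} \<Longrightarrow> f ` L i = L' i"
proof -
  interpret A: line_forms n L l by fact
  interpret B: line_forms n L' l' by fact
  let ?Q = "\<lambda>i j k. sgn (det3 (l i) (l j) (l k)) = sgn (det3 (l' i) (l' j) (l' k))"
  have Q: "?Q i j k" if "i \<in> {0..n}" "j \<in> {0..n}" "k \<in> {0..n}" "i \<noteq> j" "i \<noteq> k" "j \<noteq> k" for i j k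
    using _ _ _ that
  proof (rule distinct_triples_sorted[where Q = ?Q])
    show "?Q j i k" if "?Q i j k" for i j k
      using that by (simp only: det3_swap[where u = "l i" and v = "l j"] det3_swap[where u = "l' i" and v = "l' j"] sgn_minus)
    show "?Q i k j" if "?Q i j k" for i j k
      using that by (simp only: det3_swap_last[where v = "l j" and w = "l k"] det3_swap_last[where v = "l' j" and w = "l' k"] sgn_minus)
    show "?Q i j k" if ijk: "i \<in> {0..n}" "j \<in> {0..n}" "k \<in> {0..n}" "i < j" "j < k" for i j k
    proof (cases "i = 0")
      case True
      then show ?thesis using A.increasing[of j k] B.increasing[of j k] ijk by simp
    next
      case False
      then have mem: "i \<in> {1..n}" "j \<in> {1..n}" "k \<in> {1..n}" using ijk by auto
      have "det3 (l i) (l j) (l k) \<noteq> 0" "det3 (l' i) (l' j) (l' k) \<noteq> 0"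
        using A.general[OF mem] B.general[OF mem] ijk by auto
      then show ?thesis using agree[OF mem ijk(4,5)] by (auto simp: sgn_if)
    qed
  qed
  obtain f where f: "pl_automorphism f" "\<And>i. i \<in> {0..n} \<Longrightarrow> f ` {p. l i \<bullet> homog p = 0} = {p. l' i \<bullet> homog p = 0}"
  proof (rule pl_automorphism_of_same_orientations[OF A.vector_configuration B.vector_configuration, of 0])
    show "?Q i j k" if "i \<in> {0..n}" "j \<in> {0..n}" "k \<in> {0..n}" "i \<noteq> j" "i \<noteq> k" "j \<noteq> k" for i j k
      by (rule Q[OF that])
  qed (use assms(3) A.horizon B.horizon that in auto)
  show ?thesis
  proof (rule that[OF f(1)])
    show "f ` L i = L' i" if "i \<in> {1..n}" for i
      using f(2)[of i] A.line[OF that] B.line[OF that] that by auto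
  qed
qed

text \<open>The truth value \<open>s\<close> says whether all triples agree or all disagree; in the
  second case one side is replaced by its negated forms, which describe the same lines.\<close>

lemma pl_automorphism_of_orientations:
  assumes "line_forms n L l" "line_forms n L' l'"
    and "\<And>i j k. \<lbrakk>i \<in> {1..n}; j \<in> {1..n}; k \<in> {1..n}; i < j; j < k\<rbrakk> \<Longrightarrow>
      ((0 < det3 (l i) (l j) (l k)) = (0 < det3 (l' i) (l' j) (l' k))) = s"
  obtains f where "pl_automorphism f" "\<And>i. i \<in> {1..n} \<Longrightarrow> f ` L i = L' i"
proof -
  interpret A: line_forms n L l by fact
  interpret B: line_forms n L' l' by fact
  consider "n = 0" | "n = 1" | "2 \<le> n" s | "2 \<le> n" "\<not> s" by linarith
  then show ?thesis
  proof cases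
    case 1
    then show ?thesis using that[OF pl_automorphism_id] by simp
  next
    case 2
    obtain M m M' m' where "line_forms 2 M m" "M 1 = L 1" "line_forms 2 M' m'" "M' 1 = L' 1"
      using A.extend_single_line[OF 2] B.extend_single_line[OF 2] by metis
    note M = this
    obtain f where f: "pl_automorphism f" "\<And>i. i \<in> {1..2} \<Longrightarrow> f ` M i = M' i"
      by (rule pl_automorphism_of_agreeing_orientations[OF M(1,3)]) (auto intro: that)
    show ?thesis
    proof (rule that[OF f(1)])
      show "f ` L i = L' i" if "i \<in> {1..n}" for i
        using f(2)[of 1] M(2,4) that 2 by simp
    qed
  next
    case 3
    obtain f where "pl_automorphism f" "\<And>i. i \<in> {1..n} \<Longrightarrow> f ` L i = L' i"
    proof (rule pl_automorphism_of_agreeing_orientations[OF assms(1,2) 3(1)])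
      show "(0 < det3 (l i) (l j) (l k)) = (0 < det3 (l' i) (l' j) (l' k))"
        if "i \<in> {1..n}" "j \<in> {1..n}" "k \<in> {1..n}" "i < j" "j < k" for i j k
        using assms(3)[OF that] 3(2) by simp
    qed (rule that)
    then show ?thesis by (rule that)
  next
    case 4
    have neg: "det3 (- u) (- v) (- w) = - det3 u v w" for u v w :: "'a vec3"
      unfolding det3_def by (cases u; cases v; cases w; simp add: algebra_simps)
    have agree: "(0 < det3 (l i) (l j) (l k)) = (0 < det3 (- l' i) (- l' j) (- l' k))"
      if ijk: "i \<in> {1..n}" "j \<in> {1..n}" "k \<in> {1..n}" "i < j" "j < k" for i j k
    proof -
      have "det3 (l i) (l j) (l k) \<noteq> 0" "det3 (l' i) (l' j) (l' k) \<noteq> 0"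
        using A.general[OF ijk(1-3)] B.general[OF ijk(1-3)] ijk by auto
      then show ?thesis using assms(3)[OF ijk] 4(2) by (auto simp: neg)
    qed
    obtain f where "pl_automorphism f" "\<And>i. i \<in> {1..n} \<Longrightarrow> f ` L i = L' i"
    proof (rule pl_automorphism_of_agreeing_orientations[OF assms(1) B.negated_forms 4(1)])
      fix i j k assume ijk: "i \<in> {1..n}" "j \<in> {1..n}" "k \<in> {1..n}" "i < j" "j < k"
      then show "(0 < det3 (l i) (l j) (l k)) = (0 < det3 (if i = 0 then l' 0 else - l' i)
          (if j = 0 then l' 0 else - l' j) (if k = 0 then l' 0 else - l' k))"
        using agree[OF ijk] by auto
    qed (rule that)
    then show ?thesis by (rule that)
  qed
qed

section \<open>Nook points under piecewise linear automorphisms\<close>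

lemma middle_point_on_image:
  assumes f: "pl_automorphism f" and lines: "\<And>K. K \<in> A \<Longrightarrow> is_line K \<and> is_line (f ` K)"
    and K: "K \<in> A" and mid: "middle_point_on A K p"
  shows "middle_point_on ((`) f ` A) (f ` K) (f p)"
proof -
  have inj: "inj f" using f by (simp add: pl_automorphism_def bij_is_inj)
  obtain q r where qr: "intersection_points A \<inter> K = {q, p, r}" "strictly_between q p r"
    using mid unfolding middle_point_on_def by blast
  have "intersection_points ((`) f ` A) = f ` intersection_points A"
  proof (intro equalityI subsetI)
    fix x assume "x \<in> intersection_points ((`) f ` A)"
    then obtain M N where MN: "M \<in> A" "N \<in> A" "f ` M \<noteq> f ` N" "x \<in> f ` M \<inter> f ` N"
      unfolding intersection_points_def by blast
    then have "x \<in> f ` (M \<inter> N)" "M \<noteq> N" using image_Int[OF inj] by auto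
    then show "x \<in> f ` intersection_points A" using MN unfolding intersection_points_def by blast
  next
    fix x assume "x \<in> f ` intersection_points A"
    then obtain M N where MN: "M \<in> A" "N \<in> A" "M \<noteq> N" "x \<in> f ` (M \<inter> N)"
      unfolding intersection_points_def by blast
    then have "f ` M \<noteq> f ` N" using inj by (simp add: inj_image_eq_iff)
    then show "x \<in> intersection_points ((`) f ` A)" using MN unfolding intersection_points_def by blast
  qed
  then have "intersection_points ((`) f ` A) \<inter> f ` K = f ` {q, p, r}"
    using image_Int[OF inj] qr(1) by metis
  moreover have "strictly_between (f q) (f p) (f r)"
  proof (rule pl_automorphism_between[OF f _ _ qr(2)])
    show "is_line (f ` K)" using lines K by blast
    obtain a b c where abc: "K = {(x, y). a * x + b * y = c}" using lines K unfolding is_line_def by blast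
    have "q \<in> K" "r \<in> K" using qr(1) by blast+
    then have "a * fst q + b * snd q = c" "a * fst r + b * snd r = c" by (auto simp: abc)
    then have "a * fst (along q r t) + b * snd (along q r t) = c" for t
    proof -
      have "a * fst (along q r t) + b * snd (along q r t) = (1 - t) * (a * fst q + b * snd q) + t * (a * fst r + b * snd r)"
        by (simp add: along_def algebra_simps)
      also have "\<dots> = c" unfolding \<open>a * fst q + b * snd q = c\<close> \<open>a * fst r + b * snd r = c\<close> by (simp add: algebra_simps)
      finally show ?thesis .
    qed
    then have "along q r t \<in> K" for t by (simp add: abc case_prod_beta)
    then show "f (along q r t) \<in> f ` K" for t by blast
  qed
  ultimately show ?thesis unfolding middle_point_on_def by (metis image_empty image_insert)
qed

lemma is_nook_image:
  assumes "pl_automorphism f" "\<And>K. K \<in> A \<Longrightarrow> is_line K \<and> is_line (f ` K)" "is_nook A p"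
  shows "is_nook ((`) f ` A) (f p)"
proof -
  have inj: "inj f" using assms(1) by (simp add: pl_automorphism_def bij_is_inj)
  obtain K M where KM: "K \<in> A" "M \<in> A" "K \<noteq> M" "p \<in> K \<inter> M" "middle_point_on A K p" "middle_point_on A M p"
    using assms(3) unfolding is_nook_def by blast
  then have "f ` K \<noteq> f ` M" "f p \<in> f ` K \<inter> f ` M" using inj by (auto simp: inj_image_eq_iff)
  then show ?thesis
    unfolding is_nook_def using KM(1,2) middle_point_on_image[OF assms(1,2)] KM(5,6) by blast
qed

text \<open>Every triple is connected to the triple \<open>(1, 2, 3)\<close> by changing one index at a time.\<close>

lemma constant_on_triples:
  fixes n :: nat
  assumes four: "\<And>a b c d. \<lbrakk>1 \<le> a; a < b; b < c; c < d; d \<le> n\<rbrakk> \<Longrightarrow> A a b c = A a b d \<and> A a b d = A a c d \<and> A a c d = A b c d"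
    and ijk: "1 \<le> i" "i < j" "j < k" "k \<le> n"
  shows "(A i j k :: bool) = A 1 2 3"
proof -
  have 3: "A 1 2 k = A 1 2 3" if "2 < k" "k \<le> n" for k
    using four[of 1 2 3 k] that by (cases "k = 3") auto
  have 2: "A 1 j k = A 1 2 3" if "1 < j" "j < k" "k \<le> n" for j k
    using four[of 1 2 j k] 3[of k] that by (cases "j = 2") auto
  show ?thesis
    using four[of 1 i j k] 2[of j k] 2[of i k] ijk by (cases "i = 1") auto
qed

theorem theorem5p15:
  fixes L1 L2 :: "nat \<Rightarrow> ('a::linordered_field \<times> 'a) set"
    and \<phi> :: "('a \<times> 'a) set \<Rightarrow> ('a \<times> 'a) set"
    and n :: nat
  assumes "slope_indexed_arrangement n L1"
    and "slope_indexed_arrangement n L2"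
    and "\<forall>i\<in>{1..n}. \<phi> (L1 i) = L2 i"
  shows "(arrangement_isomorphism (L1 ` {1..n}) (L2 ` {1..n}) \<phi> \<longleftrightarrow>
            (\<forall>S. S \<subseteq> {1..n} \<and> card S = 4 \<longrightarrow>
              (\<forall>a\<in>S. \<forall>b\<in>S. a \<noteq> b \<longrightarrow>
                (L1 a \<inter> L1 b = {nook_point (L1 ` S)} \<longleftrightarrow>
                 L2 a \<inter> L2 b = {nook_point (L2 ` S)}))))
         \<and>
         (arrangement_isomorphism (L1 ` {1..n}) (L2 ` {1..n}) \<phi> \<longrightarrow>
            (\<exists>c.
              (\<forall>S. S \<subseteq> {1..n} \<and> card S = 4 \<longrightarrow>
                (\<exists>a\<in>S. \<exists>b\<in>S. a \<noteq> b \<and>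
                  L1 a \<inter> L1 b = {nook_point (L1 ` S)} \<and>
                  (L2 \<circ> cyclic_shift n c) a \<inter> (L2 \<circ> cyclic_shift n c) b =
                    {nook_point ((L2 \<circ> cyclic_shift n c) ` S)}))))"
    (is "(?iso \<longleftrightarrow> ?nooks) \<and> (?iso \<longrightarrow> ?shift)")
proof -
  obtain l1 l2 where "line_forms n L1 l1" "line_forms n L2 l2"
    using line_forms_exist[OF assms(1)] line_forms_exist[OF assms(2)] by metis
  then interpret A: line_forms n L1 l1 + B: line_forms n L2 l2 .
  have lines: "is_line (L1 i)" "is_line (L2 i)" if "i \<in> {1..n}" for i
    using assms(1,2) that by (simp_all add: slope_indexed_arrangement_def line_arrangement_def)
  have forward: ?nooks if iso: ?iso
  proof (intro allI impI ballI)
    fix S a b assume S_four: "S \<subseteq> {1..n} \<and> card S = 4" and ab: "a \<in> S" "b \<in> S" "a \<noteq> b"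
    then have S: "S \<subseteq> {1..n}" "card S = 4" by auto
    obtain f where f: "pl_automorphism f" "\<And>i. i \<in> {1..n} \<Longrightarrow> f ` L1 i = L2 i"
      using iso assms(3) unfolding arrangement_isomorphism_def by (metis imageI)
    have inj: "inj f" using f(1) by (simp add: pl_automorphism_def bij_is_inj)
    have "is_line K \<and> is_line (f ` K)" if "K \<in> L1 ` S" for K
      using that S lines f(2) by (metis imageE subsetD)
    moreover have "is_nook (L1 ` S) (nook_point (L1 ` S))"
      unfolding nook_point_is_nook by (rule theI'[OF A.ex1_nook[OF S]])
    ultimately have "is_nook ((`) f ` (L1 ` S)) (f (nook_point (L1 ` S)))"
      by (intro is_nook_image[OF f(1)])
    moreover have "(`) f ` (L1 ` S) = L2 ` S"
      unfolding image_image using S(1) f(2) by (intro image_cong) blast+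
    ultimately have "is_nook (L2 ` S) (f (nook_point (L1 ` S)))" by simp
    then have "nook_point (L2 ` S) = f (nook_point (L1 ` S))"
      \<comment> \<open>The image of the first nook is a nook of the second arrangement, which has
        only one.\<close>
      unfolding nook_point_is_nook[of "L2 ` S"] by (rule the1_equality[OF B.ex1_nook[OF S]])
    moreover have "L2 a \<inter> L2 b = f ` (L1 a \<inter> L1 b)"
    proof -
      have "a \<in> {1..n}" "b \<in> {1..n}" using ab S(1) by blast+
      then show ?thesis using f(2) image_Int[OF inj] by metis
    qed
    ultimately show "L1 a \<inter> L1 b = {nook_point (L1 ` S)} \<longleftrightarrow> L2 a \<inter> L2 b = {nook_point (L2 ` S)}"
      using inj_image_eq_iff[OF inj, of "L1 a \<inter> L1 b" "{nook_point (L1 ` S)}"] by simp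
  qed
  have backward: ?iso if nooks: ?nooks
  proof -
    define agree where "agree i j k \<longleftrightarrow> A.pos i j k = B.pos i j k" for i j k
    have four: "agree a b c = agree a b d \<and> agree a b d = agree a c d \<and> agree a c d = agree b c d"
      if lt: "1 \<le> a" "a < b" "b < c" "c < d" "d \<le> n" for a b c d
    proof -
      define S where "S = {a, b, c, d}"
      have mem: "a \<in> {1..n}" "b \<in> {1..n}" "c \<in> {1..n}" "d \<in> {1..n}" using lt by auto
      have S: "S \<subseteq> {1..n}" "card S = 4" using mem lt by (auto simp: S_def)
      have same: "A.nook_pair S i j \<longleftrightarrow> B.nook_pair S i j" if "i \<in> S" "j \<in> S" "i \<noteq> j" for i j
        using nooks S that A.nook_point_iff[OF S that] B.nook_point_iff[OF S that] by blast
      have "A.nook_pair S a b \<longleftrightarrow> B.nook_pair S a b" "A.nook_pair S c d \<longleftrightarrow> B.nook_pair S c d"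
        "A.nook_pair S a d \<longleftrightarrow> B.nook_pair S a d"
        by (rule same; use lt in \<open>auto simp: S_def\<close>)+
      then show ?thesis
        \<comment> \<open>Each of these nook pairs states that two neighbouring orientations differ.
          If they differ in both arrangements or in neither, agreement passes from one triple to the
          next.\<close>
        unfolding A.nook_pairs_four[OF mem lt(2-4) S_def] B.nook_pairs_four[OF mem lt(2-4) S_def] agree_def
        by argo
    qed
    \<comment> \<open>Agreement is constant on triples, so its value at \<open>1 2 3\<close> serves
      for all; for \<open>n < 3\<close> there are no triples and the value is arbitrary.\<close>
    obtain f where f: "pl_automorphism f" "\<And>i. i \<in> {1..n} \<Longrightarrow> f ` L1 i = L2 i"
    proof (rule pl_automorphism_of_orientations[OF A.line_forms_axioms B.line_forms_axioms])
      show "(A.pos i j k = B.pos i j k) = agree 1 2 3"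
        if "i \<in> {1..n}" "j \<in> {1..n}" "k \<in> {1..n}" "i < j" "j < k" for i j k
        using constant_on_triples[of n agree i j k] four that by (simp add: agree_def)
    qed (rule that)
    have "bij_betw \<phi> (L1 ` {1..n}) (L2 ` {1..n})"
    proof (rule bij_betw_imageI)
      show "inj_on \<phi> (L1 ` {1..n})"
      proof (rule inj_onI)
        fix K M assume "K \<in> L1 ` {1..n}" "M \<in> L1 ` {1..n}" "\<phi> K = \<phi> M"
        then obtain i j where ij: "i \<in> {1..n}" "j \<in> {1..n}" "K = L1 i" "M = L1 j" by blast
        then have "L2 i = L2 j" using \<open>\<phi> K = \<phi> M\<close> assms(3) by metis
        then show "K = M" using B.line_distinct ij by blast
      qed
      show "\<phi> ` L1 ` {1..n} = L2 ` {1..n}"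
        unfolding image_image using assms(3) by (intro image_cong) auto
    qed
    moreover have "\<forall>K\<in>L1 ` {1..n}. f ` K = \<phi> K" using f(2) assms(3) by auto
    ultimately show ?iso using f(1) unfolding arrangement_isomorphism_def by blast
  qed
  have shift: ?shift if nooks: ?nooks
  proof (intro exI[of _ 0] allI impI)
    fix S assume S: "S \<subseteq> {1..n} \<and> card S = 4"
    have id: "(L2 \<circ> cyclic_shift n 0) i = L2 i" if "i \<in> S" for i
    proof -
      \<comment> \<open>For such \<open>i\<close> the number \<open>i - 1\<close> is below
        \<open>n\<close>, so the reduction modulo \<open>n\<close> leaves it unchanged.\<close>
      have "i \<in> {1..n}" using S that by blast
      then show ?thesis by (auto simp: cyclic_shift_def)
    qed
    then have "(L2 \<circ> cyclic_shift n 0) ` S = L2 ` S" by (intro image_cong) auto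
    moreover obtain a b where ab: "a \<in> S" "b \<in> S" "a \<noteq> b" "L1 a \<inter> L1 b = {nook_point (L1 ` S)}"
      using A.nook_point_exists S by blast
    moreover have "L2 a \<inter> L2 b = {nook_point (L2 ` S)}" using nooks S ab by blast
    ultimately show "\<exists>a\<in>S. \<exists>b\<in>S. a \<noteq> b \<and> L1 a \<inter> L1 b = {nook_point (L1 ` S)} \<and>
        (L2 \<circ> cyclic_shift n 0) a \<inter> (L2 \<circ> cyclic_shift n 0) b = {nook_point ((L2 \<circ> cyclic_shift n 0) ` S)}"
      using id by metis
  qed
  show ?thesis
  proof (intro conjI iffI impI)
    show ?nooks if ?iso using that by (rule forward)
    show ?iso if ?nooks using that by (rule backward)
    show ?shift if ?iso by (rule shift[OF forward[OF that]])
  qed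
qed

end
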